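(* Let $p\in(1,\infty)$ with Hölder conjugate $q$, let $N\in(1,\infty)$, let $(M,d,\mu)$ be a metric measure space and let $B$ be a bounded closed subset of $M$ with $\mu(B)<\infty$. Assume $\mu_0,\mu_1\in\mathcal{P}_p(M)$ are two probability measures such that $\mu_0\ll\mu$ and there is $\pi\in\mathrm{OptGeo}_p(\mu_0,\mu_1)$ such that, with $\mu_t=(e_t)_*\pi$, $$\lim_{t\to0}\mathcal{U}_N(\mu_t)=\mathcal{U}_N(\mu_0)\qquad\text{and}\qquad \operatorname{supp}(\mu_t)\subset B .$$ Let $\phi$ be the associated Kantorovich potential of the pair $(\mu_0,\mu_1)$ and assume that $\phi$ is Lipschitz on bounded subsets of $M$. Then for every $\tilde\pi\in\mathrm{OptGeo}_p(\mu_0,\mu_1)$ $$d(\gamma_0,\gamma_1)^p=\big(|D^+\phi|(\gamma_0)\big)^q\qquad\text{for }\tilde\pi\text{-a.e. }\gamma .$$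
   Context: Standing assumption: $(M,d)$ is a proper geodesic space and $\mu$ is a locally finite Borel measure. $c_p(x,y)=d^p(x,y)/p$; $\mathcal{P}_p(M)$ is the set of probability measures with finite $p$-th moment. $\mathrm{Geo}(M)$ is the space of constant speed minimal geodesics $\gamma:[0,1]\to M$, $e_t(\gamma)=\gamma_t$. $\mathrm{OptGeo}_p(\mu_0,\mu_1)$ is the set of $\pi\in\mathcal{P}(\mathrm{Geo}(M))$ such that $(e_0,e_1)_*\pi$ is an optimal coupling of $(\mu_0,\mu_1)$ for the cost $c_p$. $\phi^{c_p}(y)=\inf_x\{c_p(x,y)-\phi(x)\}$. A function $\phi$, not identically $-\infty$, is $c_p$-concave if $\phi(x)=\inf_y\{c_p(x,y)-\psi(y)\}$ for some $\psi:M\to\mathbb{R}\cup\{-\infty\}$. A Kantorovich potential of $(\mu_0,\mu_1)$ is a $c_p$-concave $\phi$ such that $(\phi,\phi^{c_p})$ attains the dual problem, i.e. $\int\phi\,d\mu_0+\int\phi^{c_p}d\mu_1=\inf_\pi\int c_p\,d\pi$ (infimum over couplings of $(\mu_0,\mu_1)$). $\mathcal{U}_N(\nu)=\int U_N(\rho)\,d\mu+U_N'(\infty)\nu_s(M)$ for $\nu=\rho\mu+\nu_s$ (Lebesgue decomposition), with $U_N(r)=Nr(1-r^{-1/N})$, $U_N(0)=0$, and $U_N'(\infty)=\lim_{r\to\infty}U_N(r)/r=N$. $|D^+\phi|(x)=\limsup_{y\to x}\frac{[\phi(y)-\phi(x)]_+}{d(y,x)}$ with $[r]_+=\max\{0,r\}$.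 *)

theory Defs
  imports "HOL-Probability.Probability"
begin

text \<open>
  Proper metric spaces are the types of class \<^class>\<open>heine_borel\<close>. They are second countable, so
  that the Borel sets of a product are the product of the Borel sets.
\<close>

instance heine_borel \<subseteq> second_countable_topology
proof
  fix a :: 'a
  have "\<exists>K. finite K \<and> cball a (real n) \<subseteq> (\<Union>x\<in>K. ball x (1 / real (Suc m)))" for n m
  proof -
    have "compact (cball a (real n))"
      by (simp add: compact_eq_bounded_closed)
    then have "\<forall>e>0. \<exists>K. finite K \<and> cball a (real n) \<subseteq> (\<Union>x\<in>K. ball x e)"
      by (simp add: compact_eq_totally_bounded)
    then show ?thesis
      by (meson divide_pos_pos of_nat_0_less_iff zero_less_Suc zero_less_one)
  qed
  then obtain K where K: "\<And>n m. finite (K n m)"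
      "\<And>n m. cball a (real n) \<subseteq> (\<Union>x\<in>K n m. ball x (1 / real (Suc m)))"
    by metis
  define B where "B = (\<Union>n m. (\<lambda>x. ball x (1 / real (Suc m))) ` K n m)"
  have "countable B"
    unfolding B_def using K(1) by (intro countable_UN countable_image) (auto intro: countable_finite)
  moreover have "topological_basis B"
  proof (rule topological_basisI)
    fix b assume "b \<in> B" then show "open b" by (auto simp: B_def)
  next
    fix U :: "'a set" and x assume "open U" "x \<in> U"
    then obtain e where e: "e > 0" "ball x e \<subseteq> U"
      using open_contains_ball by blast
    obtain m where m: "1 / real (Suc m) < e / 2"
      using e(1) nat_approx_posE[of "e / 2"] by auto
    obtain n where "dist a x \<le> real n"
      using real_arch_simple by blast
    then obtain y where y: "y \<in> K n m" "dist y x < 1 / real (Suc m)"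
      using K(2)[of n m] by (auto simp: subset_iff)
    have "ball y (1 / real (Suc m)) \<subseteq> ball x e"
    proof
      fix z assume "z \<in> ball y (1 / real (Suc m))"
      then have "dist y z < 1 / real (Suc m)" by simp
      moreover have "dist x z \<le> dist y x + dist y z"
        by (metis dist_commute dist_triangle)
      ultimately show "z \<in> ball x e"
        using y(2) m unfolding mem_ball by linarith
    qed
    then show "\<exists>b\<in>B. x \<in> b \<and> b \<subseteq> U"
      using y e(2) by (intro bexI[of _ "ball y (1 / real (Suc m))"]) (auto simp: B_def)
  qed
  ultimately show "\<exists>B::'a set set. countable B \<and> open = generate_topology B"
    using topological_basis_imp_subbasis by blast
qed

definition locally_finite_borel_measure :: "'a::topological_space measure \<Rightarrow> bool" where
  "locally_finite_borel_measure \<mu> \<longleftrightarrow>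
     sets \<mu> = sets borel \<and> (\<forall>x. \<exists>U. open U \<and> x \<in> U \<and> emeasure \<mu> U < \<infinity>)"

definition measure_supp :: "'a::topological_space measure \<Rightarrow> 'a set" where
  "measure_supp \<nu> = {x. \<forall>U. open U \<and> x \<in> U \<longrightarrow> emeasure \<nu> U > 0}"

text \<open>
  A curve on \<open>[0, 1]\<close> is encoded as the bounded continuous curve on the real line that is constant
  to the left of \<open>0\<close> and to the right of \<open>1\<close>. This preserves the supremum distance, so the Borel
  sets below are those of the topology of uniform convergence on \<open>[0, 1]\<close>.
\<close>

definition Geo :: "(real \<Rightarrow>\<^sub>C 'a::metric_space) set" where
  "Geo = {\<gamma> :: real \<Rightarrow>\<^sub>C 'a. (\<forall>s\<in>{0..1}. \<forall>t\<in>{0..1}. dist (\<gamma> s) (\<gamma> t) = \<bar>s - t\<bar> * dist (\<gamma> 0) (\<gamma> 1)) \<and>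
             (\<forall>t. \<gamma> t = \<gamma> (max 0 (min 1 t)))}"

definition geodesic_space :: "'a::metric_space itself \<Rightarrow> bool" where
  "geodesic_space _ \<longleftrightarrow> (\<forall>x y :: 'a. \<exists>\<gamma> :: real \<Rightarrow>\<^sub>C 'a. \<gamma> \<in> Geo \<and> \<gamma> 0 = x \<and> \<gamma> 1 = y)"

definition prob_moment :: "real \<Rightarrow> 'a::metric_space measure set" where
  "prob_moment p = {\<nu>. prob_space \<nu> \<and> sets \<nu> = sets borel \<and>
     (\<exists>x\<^sub>0. (\<integral>\<^sup>+x. ennreal (dist x\<^sub>0 x powr p) \<partial>\<nu>) < \<infinity>)}"

definition cost :: "real \<Rightarrow> 'a::metric_space \<Rightarrow> 'a \<Rightarrow> real" where
  "cost p x y = dist x y powr p / p"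

definition couplings :: "'a::topological_space measure \<Rightarrow> 'a measure \<Rightarrow> ('a \<times> 'a) measure set" where
  "couplings \<mu>\<^sub>0 \<mu>\<^sub>1 = {\<sigma>. prob_space \<sigma> \<and> sets \<sigma> = sets borel \<and>
     distr \<sigma> borel fst = \<mu>\<^sub>0 \<and> distr \<sigma> borel snd = \<mu>\<^sub>1}"

definition coupling_cost :: "real \<Rightarrow> ('a::metric_space \<times> 'a) measure \<Rightarrow> ennreal" where
  "coupling_cost p \<sigma> = (\<integral>\<^sup>+z. ennreal (cost p (fst z) (snd z)) \<partial>\<sigma>)"

definition transport_cost :: "real \<Rightarrow> 'a::metric_space measure \<Rightarrow> 'a measure \<Rightarrow> ennreal" where
  "transport_cost p \<mu>\<^sub>0 \<mu>\<^sub>1 = (INF \<sigma>\<in>couplings \<mu>\<^sub>0 \<mu>\<^sub>1. coupling_cost p \<sigma>)"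

definition optimal_couplings ::
    "real \<Rightarrow> 'a::metric_space measure \<Rightarrow> 'a measure \<Rightarrow> ('a \<times> 'a) measure set" where
  "optimal_couplings p \<mu>\<^sub>0 \<mu>\<^sub>1 =
     {\<sigma> \<in> couplings \<mu>\<^sub>0 \<mu>\<^sub>1. coupling_cost p \<sigma> = transport_cost p \<mu>\<^sub>0 \<mu>\<^sub>1}"

definition OptGeo ::
    "real \<Rightarrow> 'a::metric_space measure \<Rightarrow> 'a measure \<Rightarrow> (real \<Rightarrow>\<^sub>C 'a) measure set" where
  "OptGeo p \<mu>\<^sub>0 \<mu>\<^sub>1 = {\<pi>. prob_space \<pi> \<and> sets \<pi> = sets (restrict_space borel Geo) \<and>
     distr \<pi> borel (\<lambda>\<gamma> :: real \<Rightarrow>\<^sub>C 'a. (\<gamma> 0, \<gamma> 1)) \<in> optimal_couplings p \<mu>\<^sub>0 \<mu>\<^sub>1}"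

definition eval_measure :: "(real \<Rightarrow>\<^sub>C 'a::metric_space) measure \<Rightarrow> real \<Rightarrow> 'a measure" where
  "eval_measure \<pi> t = distr \<pi> borel (\<lambda>\<gamma> :: real \<Rightarrow>\<^sub>C 'a. \<gamma> t)"

text \<open>
  The value is the usual one whenever the positive or the negative part has a finite integral.
  For \<open>\<infinity> - \<infinity>\<close> it is \<open>\<infinity>\<close>; in the uses below the positive parts are integrable or a finite value
  is demanded.
\<close>

definition ereal_integral :: "'a measure \<Rightarrow> ('a \<Rightarrow> ereal) \<Rightarrow> ereal" where
  "ereal_integral M f =
     enn2ereal (\<integral>\<^sup>+x. e2ennreal (f x) \<partial>M) - enn2ereal (\<integral>\<^sup>+x. e2ennreal (- f x) \<partial>M)"

text \<open>Functions with values in \<open>\<real> \<union> {-\<infinity>}\<close> are \<^typ>\<open>ereal\<close>-valued functions omitting \<open>\<infinity>\<close>.\<close>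

definition c_transform :: "real \<Rightarrow> ('a::metric_space \<Rightarrow> ereal) \<Rightarrow> 'a \<Rightarrow> ereal" where
  "c_transform p \<phi> y = (INF x. ereal (cost p x y) - \<phi> x)"

definition c_concave :: "real \<Rightarrow> ('a::metric_space \<Rightarrow> ereal) \<Rightarrow> bool" where
  "c_concave p \<phi> \<longleftrightarrow> (\<forall>x. \<phi> x \<noteq> \<infinity>) \<and> (\<exists>x. \<phi> x \<noteq> -\<infinity>) \<and>
     (\<exists>\<psi>. (\<forall>y. \<psi> y \<noteq> \<infinity>) \<and> (\<forall>x. \<phi> x = (INF y. ereal (cost p x y) - \<psi> y)))"

definition kantorovich_potential ::
    "real \<Rightarrow> 'a::metric_space measure \<Rightarrow> 'a measure \<Rightarrow> ('a \<Rightarrow> ereal) \<Rightarrow> bool" where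
  "kantorovich_potential p \<mu>\<^sub>0 \<mu>\<^sub>1 \<phi> \<longleftrightarrow> c_concave p \<phi> \<and>
     ereal_integral \<mu>\<^sub>0 \<phi> + ereal_integral \<mu>\<^sub>1 (c_transform p \<phi>) =
       enn2ereal (transport_cost p \<mu>\<^sub>0 \<mu>\<^sub>1)"

definition lebesgue_decomposition ::
    "'a measure \<Rightarrow> 'a measure \<Rightarrow> ('a \<Rightarrow> real) \<Rightarrow> 'a measure \<Rightarrow> bool" where
  "lebesgue_decomposition \<mu> \<nu> \<rho> \<nu>\<^sub>s \<longleftrightarrow>
     \<rho> \<in> borel_measurable \<mu> \<and> (\<forall>x. \<rho> x \<ge> 0) \<and> sets \<nu>\<^sub>s = sets \<mu> \<and>
     (\<forall>A\<in>sets \<mu>. emeasure \<nu> A = emeasure (density \<mu> (\<lambda>x. ennreal (\<rho> x))) A + emeasure \<nu>\<^sub>s A) \<and>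
     (\<exists>S\<in>null_sets \<mu>. emeasure \<nu>\<^sub>s (space \<mu> - S) = 0)"

definition U_fun :: "real \<Rightarrow> real \<Rightarrow> real" where
  "U_fun N r = N * r * (1 - r powr (- 1 / N))"

text \<open>
  The factor \<open>N\<close> of the singular part is the limit of \<open>U_fun N r / r\<close> for \<open>r \<rightarrow> \<infinity>\<close>. For
  \<open>\<sigma>\<close>-finite \<open>\<mu>\<close> and finite \<open>\<nu>\<close> the Lebesgue decomposition exists and is unique up to null sets of
  \<open>\<mu>\<close>, so the value is well defined.
\<close>

definition entropy_functional :: "real \<Rightarrow> 'a measure \<Rightarrow> 'a measure \<Rightarrow> ereal" where
  "entropy_functional N \<mu> \<nu> =
     (THE u. \<exists>\<rho> \<nu>\<^sub>s. lebesgue_decomposition \<mu> \<nu> \<rho> \<nu>\<^sub>s \<and>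
        u = ereal_integral \<mu> (\<lambda>x. ereal (U_fun N (\<rho> x))) + ereal N * enn2ereal (emeasure \<nu>\<^sub>s (space \<nu>\<^sub>s)))"

text \<open>In \<^typ>\<open>ennreal\<close> the limes superior at an isolated point is \<open>0\<close>, the usual convention.\<close>

definition ascending_slope :: "('a::metric_space \<Rightarrow> real) \<Rightarrow> 'a \<Rightarrow> ennreal" where
  "ascending_slope \<phi> x = Limsup (at x) (\<lambda>y. ennreal (max 0 (\<phi> y - \<phi> x) / dist y x))"

definition ennreal_powr :: "ennreal \<Rightarrow> real \<Rightarrow> ennreal" where
  \<comment> \<open>meant for positive exponents\<close>
  "ennreal_powr a r = (if a = \<infinity> then \<infinity> else ennreal (enn2real a powr r))"

definition lipschitz_on_bounded_sets :: "('a::metric_space \<Rightarrow> real) \<Rightarrow> bool" where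
  "lipschitz_on_bounded_sets \<phi> \<longleftrightarrow> (\<forall>S. bounded S \<longrightarrow> (\<exists>L. L-lipschitz_on S \<phi>))"

end

theory Submission
  imports Defs
begin

text \<open>
  Along a geodesic \<open>\<gamma>\<close> in the support of an optimal plan the potential satisfies
  \<open>\<phi> (\<gamma> 0) = c (\<gamma> 0) (\<gamma> 1) - b\<close> and \<open>\<phi> z \<le> c z (\<gamma> 1) - b\<close> for all \<open>z\<close>. Varying \<open>z\<close> near \<open>\<gamma> 0\<close> bounds the
  slope at \<open>\<gamma> 0\<close> by \<open>d (\<gamma> 0) (\<gamma> 1) powr (p - 1)\<close>. Taking \<open>z = \<gamma> t\<close> bounds the difference quotient of
  \<open>\<phi>\<close> from \<open>\<gamma> t\<close> up to \<open>\<gamma> 0\<close> from below, so with \<open>S\<^sub>r\<close> the supremum of the ascending difference quotients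
  over a ball of radius \<open>r\<close>, the integral of \<open>S\<^sub>r powr q\<close> against \<open>\<mu>\<^sub>t\<close> is at least \<open>(1 - t) powr p\<close> times
  the integral of \<open>d powr p\<close>. Letting \<open>t\<close> and then \<open>r\<close> tend to \<open>0\<close> gives an integrated inequality opposite to
  the pointwise one, hence equality almost everywhere.

  The limit \<open>t \<rightarrow> 0\<close> needs more than weak convergence, as \<open>S\<^sub>r\<close> is only semicontinuous. This is
  where the entropy enters: by Young's inequality the integral of \<open>\<rho>\<^sub>t powr (1 - 1 / N)\<close> is at most
  \<open>1 / N\<close> times that of \<open>(h + \<delta> f) powr (1 - N)\<close> plus \<open>1 - 1 / N\<close> times the \<open>\<mu>\<^sub>t\<close>-integral of \<open>h + \<delta> f\<close>,
  where \<open>f\<close> is Borel and only \<open>h\<close> is continuous. One lets \<open>t \<rightarrow> 0\<close>, approximates the optimal choice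
  \<open>h = \<rho>\<^sub>0 powr (- 1 / N)\<close>, for which both sides agree at \<open>\<delta> = 0\<close>, and differentiates in \<open>\<delta>\<close>.
\<close>

section \<open>Lebesgue decompositions and the entropy\<close>

text \<open>Take a \<open>\<mu>\<close>-null set \<open>S\<close> of largest possible
  \<open>\<nu>\<close>-measure; a countable union of null sets attains the supremum
  \<open>c\<close>. Off \<open>S\<close> the measure \<open>\<nu>\<close> is absolutely continuous,
  since a null set \<open>E\<close> with \<open>\<nu> (E - S) > 0\<close> would make
  \<open>S \<union> E\<close> exceed \<open>c\<close>. Radon-Nikodym then supplies the
  density.\<close>

lemma lebesgue_decomposition_exists:
  assumes "sigma_finite_measure \<mu>" "finite_measure \<nu>" and sets [measurable_cong]: "sets \<nu> = sets \<mu>"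
  shows "\<exists>\<rho> \<nu>\<^sub>s. lebesgue_decomposition \<mu> \<nu> \<rho> \<nu>\<^sub>s"
proof -
  interpret \<mu>: sigma_finite_measure \<mu> by fact
  interpret \<nu>: finite_measure \<nu> by fact
  define c where "c = (SUP A\<in>null_sets \<mu>. emeasure \<nu> A)"
  have "emeasure \<nu> ` null_sets \<mu> \<noteq> {}" by auto
  then obtain g :: "nat \<Rightarrow> ennreal" where g: "range g \<subseteq> emeasure \<nu> ` null_sets \<mu>" "c = Sup (range g)"
    unfolding c_def using ennreal_Sup_countable_SUP[of "emeasure \<nu> ` null_sets \<mu>"] by metis
  then have "\<forall>n. \<exists>A\<in>null_sets \<mu>. g n = emeasure \<nu> A" by (auto simp: image_subset_iff)
  then obtain A where A: "\<And>n::nat. A n \<in> null_sets \<mu>" "\<And>n. g n = emeasure \<nu> (A n)" by metis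
  define S where "S = (\<Union>n. A n)"
  have S: "S \<in> null_sets \<mu>" unfolding S_def using A by auto
  then have S_sets [measurable]: "S \<in> sets \<mu>" by auto
  have le: "c \<le> emeasure \<nu> S" unfolding g(2)
    using A S_sets by (intro SUP_least) (auto simp: S_def sets intro!: emeasure_mono)
  define \<nu>' where "\<nu>' = density \<nu> (indicator (space \<mu> - S))"
  have nu': "emeasure \<nu>' E = emeasure \<nu> (E - S)" if "E \<in> sets \<mu>" for E
  proof -
    have "(space \<mu> - S) \<inter> E = E - S" using sets.sets_into_space[OF that] by auto
    then show ?thesis
      using that unfolding \<nu>'_def by (subst emeasure_density) (auto simp: sets simp flip: indicator_inter_arith)
  qed
  have "absolutely_continuous \<mu> \<nu>'"
    unfolding absolutely_continuous_def
  proof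
    fix E assume E: "E \<in> null_sets \<mu>"
    then have [measurable]: "E \<in> sets \<mu>" by auto
    have "S \<union> E \<in> null_sets \<mu>" using S E by auto
    then have "emeasure \<nu> (S \<union> E) \<le> c" unfolding c_def by (rule SUP_upper)
    moreover have "emeasure \<nu> (S \<union> E) = emeasure \<nu> S + emeasure \<nu> (E - S)"
      by (subst plus_emeasure) (auto intro!: arg_cong[where f="emeasure \<nu>"])
    ultimately have "emeasure \<nu> S + emeasure \<nu> (E - S) \<le> emeasure \<nu> S + 0"
      \<comment> \<open>Since \<open>\<nu>\<close> is finite, \<open>emeasure \<nu> S\<close> can be
        cancelled.\<close>
      using le by (metis order_trans add.right_neutral)
    then have "emeasure \<nu> (E - S) \<le> 0"
      using \<nu>.emeasure_finite[of S] unfolding ennreal_add_left_cancel_le by simp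
    then have "emeasure \<nu> (E - S) = 0" by simp
    then show "E \<in> null_sets \<nu>'" using nu'[of E] by (auto simp: null_sets_def \<nu>'_def sets)
  qed
  moreover have sets': "sets \<nu>' = sets \<mu>" by (simp add: \<nu>'_def sets)
  ultimately obtain f where f [measurable]: "f \<in> borel_measurable \<mu>" and fd: "density \<mu> f = \<nu>'"
    using \<mu>.Radon_Nikodym by blast
  have "(\<integral>\<^sup>+x. f x \<partial>\<mu>) = emeasure \<nu>' (space \<mu>)"
    unfolding fd[symmetric] by (subst emeasure_density) (auto intro!: nn_integral_cong)
  also have "\<dots> \<noteq> \<infinity>" using nu'[of "space \<mu>"] \<nu>.emeasure_finite by auto
  finally have fin: "AE x in \<mu>. f x \<noteq> \<infinity>" by (intro nn_integral_noteq_infinite) auto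
  \<comment> \<open>Decompositions carry real densities. The density \<open>f\<close> is finite
    almost everywhere because \<open>\<nu>\<close> is finite, so passing to reals changes it only on
    a null set.\<close>
  define \<rho> where "\<rho> x = enn2real (f x)" for x
  have [measurable]: "\<rho> \<in> borel_measurable \<mu>" unfolding \<rho>_def by measurable
  have d: "density \<mu> (\<lambda>x. ennreal (\<rho> x)) = \<nu>'"
    unfolding fd[symmetric]
  proof (rule density_cong)
    show "AE x in \<mu>. ennreal (\<rho> x) = f x" using fin by eventually_elim (simp add: \<rho>_def less_top)
  qed auto
  have "lebesgue_decomposition \<mu> \<nu> \<rho> (density \<nu> (indicator S))"
    unfolding lebesgue_decomposition_def d
  proof (intro conjI ballI bexI)
    fix E assume E [measurable]: "E \<in> sets \<mu>"
    have "emeasure (density \<nu> (indicator S)) E = emeasure \<nu> (S \<inter> E)"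
      by (subst emeasure_density) (auto simp: sets simp flip: indicator_inter_arith)
    then show "emeasure \<nu> E = emeasure \<nu>' E + emeasure (density \<nu> (indicator S)) E"
      using nu'[OF E] by (simp, subst plus_emeasure) (auto intro!: arg_cong[where f="emeasure \<nu>"])
  next
    show "emeasure (density \<nu> (indicator S)) (space \<mu> - S) = 0"
      by (subst emeasure_density) (auto simp: sets simp flip: indicator_inter_arith)
  qed (auto simp: sets S \<rho>_def)
  then show ?thesis by blast
qed

text \<open>The singular part lives on \<open>S\<close>, which the density does not see. Every
  larger null set \<open>T\<close> is allowed so that two decompositions of the same measure can be
  compared off the union of their exceptional sets.\<close>

lemma lebesgue_decomposition_off_null:
  assumes "lebesgue_decomposition \<mu> \<nu> \<rho> \<nu>\<^sub>s"
  obtains S where "S \<in> null_sets \<mu>"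
    and "\<And>T A. S \<subseteq> T \<Longrightarrow> T \<in> null_sets \<mu> \<Longrightarrow> A \<in> sets \<mu> \<Longrightarrow>
      emeasure (density \<mu> (\<lambda>x. ennreal (\<rho> x))) A = emeasure \<nu> (A - T)"
proof -
  have [measurable]: "\<rho> \<in> borel_measurable \<mu>" and s: "sets \<nu>\<^sub>s = sets \<mu>"
    and e: "\<And>A. A \<in> sets \<mu> \<Longrightarrow> emeasure \<nu> A = emeasure (density \<mu> (\<lambda>x. ennreal (\<rho> x))) A + emeasure \<nu>\<^sub>s A"
    using assms by (auto simp: lebesgue_decomposition_def)
  obtain S where S: "S \<in> null_sets \<mu>" "emeasure \<nu>\<^sub>s (space \<mu> - S) = 0"
    using assms by (auto simp: lebesgue_decomposition_def)
  show ?thesis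
  proof (rule that[OF S(1)])
    fix T A assume T: "S \<subseteq> T" "T \<in> null_sets \<mu>" and A [measurable]: "A \<in> sets \<mu>"
    have [measurable]: "T \<in> sets \<mu>" "S \<in> sets \<mu>" using T S by auto
    have "emeasure \<nu>\<^sub>s (A - T) \<le> emeasure \<nu>\<^sub>s (space \<mu> - S)"
      using T(1) sets.sets_into_space[OF A] by (intro emeasure_mono) (auto simp: s)
    then have "emeasure \<nu> (A - T) = emeasure (density \<mu> (\<lambda>x. ennreal (\<rho> x))) (A - T)"
      using S(2) by (simp add: e)
    also have "\<dots> = emeasure (density \<mu> (\<lambda>x. ennreal (\<rho> x))) A"
    proof (rule emeasure_Diff_null_set)
      show "T \<in> null_sets (density \<mu> (\<lambda>x. ennreal (\<rho> x)))"
        using T(2) absolutely_continuousI_density[of "\<lambda>x. ennreal (\<rho> x)" \<mu>]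
        by (auto simp: absolutely_continuous_def)
    qed auto
    finally show "emeasure (density \<mu> (\<lambda>x. ennreal (\<rho> x))) A = emeasure \<nu> (A - T)" by simp
  qed
qed

lemma lebesgue_decomposition_unique:
  assumes "sigma_finite_measure \<mu>"
    and d: "lebesgue_decomposition \<mu> \<nu> \<rho> \<nu>\<^sub>s" and d': "lebesgue_decomposition \<mu> \<nu> \<rho>' \<nu>\<^sub>s'"
  shows "AE x in \<mu>. \<rho> x = \<rho>' x"
proof -
  interpret \<mu>: sigma_finite_measure \<mu> by fact
  have [measurable]: "\<rho> \<in> borel_measurable \<mu>" "\<rho>' \<in> borel_measurable \<mu>"
    and nonneg: "\<And>x. \<rho> x \<ge> 0" "\<And>x. \<rho>' x \<ge> 0"
    using d d' by (auto simp: lebesgue_decomposition_def)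
  obtain S where S: "S \<in> null_sets \<mu>" "\<And>T A. S \<subseteq> T \<Longrightarrow> T \<in> null_sets \<mu> \<Longrightarrow> A \<in> sets \<mu> \<Longrightarrow>
      emeasure (density \<mu> (\<lambda>x. ennreal (\<rho> x))) A = emeasure \<nu> (A - T)"
    using lebesgue_decomposition_off_null[OF d] by metis
  obtain S' where S': "S' \<in> null_sets \<mu>" "\<And>T A. S' \<subseteq> T \<Longrightarrow> T \<in> null_sets \<mu> \<Longrightarrow> A \<in> sets \<mu> \<Longrightarrow>
      emeasure (density \<mu> (\<lambda>x. ennreal (\<rho>' x))) A = emeasure \<nu> (A - T)"
    using lebesgue_decomposition_off_null[OF d'] by metis
  have N: "S \<union> S' \<in> null_sets \<mu>" using S(1) S'(1) by auto
  have "density \<mu> (\<lambda>x. ennreal (\<rho> x)) = density \<mu> (\<lambda>x. ennreal (\<rho>' x))"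
    by (rule measure_eqI) (auto simp: S(2)[OF _ N] S'(2)[OF _ N])
  then have "AE x in \<mu>. ennreal (\<rho> x) = ennreal (\<rho>' x)"
    by (subst (asm) \<mu>.density_unique_iff) auto
  then show ?thesis by eventually_elim (use nonneg in auto)
qed

lemma lebesgue_decomposition_absolutely_continuous:
  assumes ac: "absolutely_continuous \<mu> \<nu>" and sets: "sets \<nu> = sets \<mu>"
    and d: "lebesgue_decomposition \<mu> \<nu> \<rho> \<nu>\<^sub>s"
  shows "density \<mu> (\<lambda>x. ennreal (\<rho> x)) = \<nu>"
proof (rule measure_eqI)
  fix A assume "A \<in> sets (density \<mu> (\<lambda>x. ennreal (\<rho> x)))"
  then have A: "A \<in> sets \<mu>" by simp
  obtain S where S: "S \<in> null_sets \<mu>" "\<And>T A. S \<subseteq> T \<Longrightarrow> T \<in> null_sets \<mu> \<Longrightarrow> A \<in> sets \<mu> \<Longrightarrow>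
      emeasure (density \<mu> (\<lambda>x. ennreal (\<rho> x))) A = emeasure \<nu> (A - T)"
    using lebesgue_decomposition_off_null[OF d] by metis
  have "S \<in> null_sets \<nu>" using S(1) ac by (auto simp: absolutely_continuous_def)
  then show "emeasure (density \<mu> (\<lambda>x. ennreal (\<rho> x))) A = emeasure \<nu> A"
    using S(2)[OF order_refl S(1) A] A sets by (simp add: emeasure_Diff_null_set)
qed (simp add: sets)

section \<open>Evaluation of the entropy functional\<close>

lemma ereal_integral_real:
  assumes "integrable M f"
  shows "ereal_integral M (\<lambda>x. ereal (f x)) = ereal (\<integral>x. f x \<partial>M)"
proof -
  have [measurable]: "f \<in> borel_measurable M" using assms by auto
  have "e2ennreal (ereal (f x)) = ennreal (f x)" "e2ennreal (- ereal (f x)) = ennreal (- f x)" for x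
    by (simp_all add: ennreal_def e2ennreal_def sup_max) 
  then have *: "ereal_integral M (\<lambda>x. ereal (f x)) =
      enn2ereal (\<integral>\<^sup>+x. ennreal (f x) \<partial>M) - enn2ereal (\<integral>\<^sup>+x. ennreal (- f x) \<partial>M)"
    by (simp add: ereal_integral_def)
  have "(\<integral>\<^sup>+x. ennreal (f x) \<partial>M) \<noteq> \<infinity>" "(\<integral>\<^sup>+x. ennreal (- f x) \<partial>M) \<noteq> \<infinity>"
    using assms by (auto simp: real_integrable_def)
  then show ?thesis unfolding * real_lebesgue_integral_def[OF assms]
    by (cases "\<integral>\<^sup>+x. ennreal (f x) \<partial>M"; cases "\<integral>\<^sup>+x. ennreal (- f x) \<partial>M") auto
qed

lemma lebesgue_decomposition_integrable:
  assumes "finite_measure \<nu>" and sets: "sets \<nu> = sets \<mu>"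
    and d: "lebesgue_decomposition \<mu> \<nu> \<rho> \<nu>\<^sub>s"
  shows "integrable \<mu> \<rho>"
    and "measure \<nu> (space \<nu>) = (\<integral>x. \<rho> x \<partial>\<mu>) + measure \<nu>\<^sub>s (space \<nu>\<^sub>s)"
    and "emeasure \<nu>\<^sub>s (space \<nu>\<^sub>s) < \<infinity>"
proof -
  interpret \<nu>: finite_measure \<nu> by fact
  have [measurable]: "\<rho> \<in> borel_measurable \<mu>" and s: "sets \<nu>\<^sub>s = sets \<mu>" and nonneg: "\<And>x. \<rho> x \<ge> 0"
    and e: "\<And>A. A \<in> sets \<mu> \<Longrightarrow> emeasure \<nu> A = emeasure (density \<mu> (\<lambda>x. ennreal (\<rho> x))) A + emeasure \<nu>\<^sub>s A"
    using d by (auto simp: lebesgue_decomposition_def)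
  have sp: "space \<nu> = space \<mu>" "space \<nu>\<^sub>s = space \<mu>"
    using sets s by (auto dest: sets_eq_imp_space_eq)
  have "(\<integral>\<^sup>+x. ennreal (\<rho> x) \<partial>\<mu>) = emeasure (density \<mu> (\<lambda>x. ennreal (\<rho> x))) (space \<mu>)"
    by (subst emeasure_density) (auto intro!: nn_integral_cong)
  then have eq: "emeasure \<nu> (space \<nu>) = (\<integral>\<^sup>+x. ennreal (\<rho> x) \<partial>\<mu>) + emeasure \<nu>\<^sub>s (space \<nu>\<^sub>s)"
    using e[of "space \<mu>"] by (simp add: sp)
  then have fin: "(\<integral>\<^sup>+x. ennreal (\<rho> x) \<partial>\<mu>) < \<infinity>" and fin': "emeasure \<nu>\<^sub>s (space \<nu>\<^sub>s) < \<infinity>"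
    using \<nu>.emeasure_finite[of "space \<nu>"] by (auto simp: less_top)
  show "emeasure \<nu>\<^sub>s (space \<nu>\<^sub>s) < \<infinity>" by (fact fin')
  show int: "integrable \<mu> \<rho>" using fin nonneg by (intro integrableI_nonneg) auto
  show "measure \<nu> (space \<nu>) = (\<integral>x. \<rho> x \<partial>\<mu>) + measure \<nu>\<^sub>s (space \<nu>\<^sub>s)"
    unfolding measure_def eq using fin fin' nonneg
    by (subst enn2real_plus) (auto simp: integral_eq_nn_integral)
qed

text \<open>For exponents in (0, 1] one has \<open>r powr a \<le> 1 + r\<close>, and the constant 1
  is integrable over \<open>B\<close>. This is how the finite measure of \<open>B\<close> makes the
  entropy integral finite.\<close>

lemma integrable_powr_concentrated:
  fixes \<rho> :: "'a \<Rightarrow> real"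
  assumes [measurable]: "B \<in> sets \<mu>" and "emeasure \<mu> B < \<infinity>" and \<rho>: "integrable \<mu> \<rho>" "\<And>x. \<rho> x \<ge> 0"
    and B: "AE x in \<mu>. x \<notin> B \<longrightarrow> \<rho> x = 0" and a: "0 < a" "a \<le> 1"
  shows "integrable \<mu> (\<lambda>x. \<rho> x powr a)"
proof (rule Bochner_Integration.integrable_bound)
  have [measurable]: "\<rho> \<in> borel_measurable \<mu>" using \<rho> by auto
  show "(\<lambda>x. \<rho> x powr a) \<in> borel_measurable \<mu>"
    by (intro powr_real_measurable) auto
  show "integrable \<mu> (\<lambda>x. indicator B x + \<rho> x)"
    using assms by (intro Bochner_Integration.integrable_add) (auto simp: integrable_indicator_iff)
  show "AE x in \<mu>. norm (\<rho> x powr a) \<le> norm (indicator B x + \<rho> x)"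
    using B
  proof eventually_elim
    case (elim x)
    have "\<rho> x powr a \<le> 1 + \<rho> x"
    proof (cases "\<rho> x \<le> 1")
      case True then show ?thesis using \<rho>(2)[of x] a powr_mono2[of a "\<rho> x" 1] by simp
    next
      case False then show ?thesis using a powr_mono[of a 1 "\<rho> x"] by simp
    qed
    then show ?case using elim \<rho>(2)[of x] by (cases "x \<in> B") auto
  qed
qed

lemma lebesgue_decomposition_concentrated:
  assumes sets: "sets \<nu> = sets \<mu>" and B [measurable]: "B \<in> sets \<mu>"
    and 0: "emeasure \<nu> (space \<mu> - B) = 0" and d: "lebesgue_decomposition \<mu> \<nu> \<rho> \<nu>\<^sub>s"
  shows "AE x in \<mu>. x \<notin> B \<longrightarrow> \<rho> x = 0"
proof -
  have [measurable]: "\<rho> \<in> borel_measurable \<mu>" and nonneg: "\<And>x. \<rho> x \<ge> 0"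
    and e: "\<And>A. A \<in> sets \<mu> \<Longrightarrow> emeasure \<nu> A = emeasure (density \<mu> (\<lambda>x. ennreal (\<rho> x))) A + emeasure \<nu>\<^sub>s A"
    using d by (auto simp: lebesgue_decomposition_def)
  have "emeasure (density \<mu> (\<lambda>x. ennreal (\<rho> x))) (space \<mu> - B) = 0"
    using e[of "space \<mu> - B"] 0 by simp
  then have "AE x in \<mu>. ennreal (\<rho> x) * indicator (space \<mu> - B) x = 0"
    by (subst (asm) emeasure_density) (auto simp: nn_integral_0_iff_AE)
  then show ?thesis using AE_space
    by eventually_elim (use nonneg in \<open>auto split: split_indicator_asm\<close>)
qed

text \<open>Write \<open>U_fun N r\<close> as \<open>N * r - N * r powr (1 - 1 / N)\<close>. The
  linear part and the weight \<open>N\<close> of the singular part add up to \<open>N\<close> times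
  the total mass, so the decomposition enters only through the integral of the power. For
  probability measures, convergence of the entropies is therefore convergence of these integrals.
  Almost everywhere uniqueness of the density makes the definite description meaningful.\<close>

lemma entropy_functional_eq:
  assumes sf: "sigma_finite_measure \<mu>" and fin: "finite_measure \<nu>" and sets: "sets \<nu> = sets \<mu>"
    and N: "N > 1" and B: "B \<in> sets \<mu>" "emeasure \<mu> B < \<infinity>" "emeasure \<nu> (space \<mu> - B) = 0"
    and d: "lebesgue_decomposition \<mu> \<nu> \<rho> \<nu>\<^sub>s"
  shows "entropy_functional N \<mu> \<nu> =
    ereal (N * measure \<nu> (space \<nu>) - N * (\<integral>x. \<rho> x powr (1 - 1 / N) \<partial>\<mu>))"
proof -
  have val: "ereal_integral \<mu> (\<lambda>x. ereal (U_fun N (\<rho>' x))) + ereal N * enn2ereal (emeasure \<nu>\<^sub>s' (space \<nu>\<^sub>s'))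
      = ereal (N * measure \<nu> (space \<nu>) - N * (\<integral>x. \<rho>' x powr (1 - 1 / N) \<partial>\<mu>))"
    if d': "lebesgue_decomposition \<mu> \<nu> \<rho>' \<nu>\<^sub>s'" for \<rho>' \<nu>\<^sub>s'
  proof -
    note i = lebesgue_decomposition_integrable[OF fin sets d']
    have nonneg: "\<And>x. \<rho>' x \<ge> 0" using d' by (auto simp: lebesgue_decomposition_def)
    have j: "integrable \<mu> (\<lambda>x. \<rho>' x powr (1 - 1 / N))"
      using lebesgue_decomposition_concentrated[OF sets B(1,3) d'] N
      by (intro integrable_powr_concentrated[OF B(1,2) i(1) nonneg]) auto
    have U: "U_fun N (\<rho>' x) = N * \<rho>' x - N * \<rho>' x powr (1 - 1 / N)" for x
    proof (cases "\<rho>' x = 0")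
      case False
      then have "\<rho>' x * \<rho>' x powr (- 1 / N) = \<rho>' x powr (1 - 1 / N)"
        using nonneg[of x] powr_add[of "\<rho>' x" 1 "- 1 / N"] by simp
      then show ?thesis by (simp add: U_fun_def algebra_simps)
    qed (simp add: U_fun_def)
    have "ereal_integral \<mu> (\<lambda>x. ereal (U_fun N (\<rho>' x))) =
        ereal (N * (\<integral>x. \<rho>' x \<partial>\<mu>) - N * (\<integral>x. \<rho>' x powr (1 - 1 / N) \<partial>\<mu>))"
      unfolding U using i(1) j by (subst ereal_integral_real) auto
    moreover have "enn2ereal (emeasure \<nu>\<^sub>s' (space \<nu>\<^sub>s')) = ereal (measure \<nu>\<^sub>s' (space \<nu>\<^sub>s'))"
      using i(3) by (subst emeasure_eq_ennreal_measure) auto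
    ultimately show ?thesis unfolding i(2) by (simp add: algebra_simps)
  qed
  show ?thesis
    unfolding entropy_functional_def
  proof (rule the_equality)
    show "\<exists>\<rho>' \<nu>\<^sub>s'. lebesgue_decomposition \<mu> \<nu> \<rho>' \<nu>\<^sub>s' \<and>
      ereal (N * measure \<nu> (space \<nu>) - N * (\<integral>x. \<rho> x powr (1 - 1 / N) \<partial>\<mu>)) =
      ereal_integral \<mu> (\<lambda>x. ereal (U_fun N (\<rho>' x))) + ereal N * enn2ereal (emeasure \<nu>\<^sub>s' (space \<nu>\<^sub>s'))"
      using val[OF d] d by metis
  next
    fix u assume "\<exists>\<rho>' \<nu>\<^sub>s'. lebesgue_decomposition \<mu> \<nu> \<rho>' \<nu>\<^sub>s' \<and>
      u = ereal_integral \<mu> (\<lambda>x. ereal (U_fun N (\<rho>' x))) + ereal N * enn2ereal (emeasure \<nu>\<^sub>s' (space \<nu>\<^sub>s'))"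
    then obtain \<rho>' \<nu>\<^sub>s' where d': "lebesgue_decomposition \<mu> \<nu> \<rho>' \<nu>\<^sub>s'"
      and u: "u = ereal (N * measure \<nu> (space \<nu>) - N * (\<integral>x. \<rho>' x powr (1 - 1 / N) \<partial>\<mu>))"
      using val by blast
    have "(\<integral>x. \<rho>' x powr (1 - 1 / N) \<partial>\<mu>) = (\<integral>x. \<rho> x powr (1 - 1 / N) \<partial>\<mu>)"
    proof (rule integral_cong_AE)
      show "AE x in \<mu>. \<rho>' x powr (1 - 1 / N) = \<rho> x powr (1 - 1 / N)"
        using lebesgue_decomposition_unique[OF sf d' d] by eventually_elim simp
    qed (use d d' in \<open>auto simp: lebesgue_decomposition_def\<close>)
    then show "u = ereal (N * measure \<nu> (space \<nu>) - N * (\<integral>x. \<rho> x powr (1 - 1 / N) \<partial>\<mu>))"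
      by (simp add: u)
  qed
qed

section \<open>Approximation by continuous functions and a Young inequality\<close>

text \<open>Inner regularity replaces \<open>A\<close> by a compact subset \<open>K\<close>, and the
  functions \<open>max 0 (1 - n * infdist x K)\<close> tend pointwise to the indicator of the closed
  set \<open>K\<close>.\<close>

lemma indicator_L1_approx_continuous:
  fixes M :: "'a::{second_countable_topology, complete_space} measure"
  assumes "finite_measure M" and sets: "sets M = sets borel" and A: "A \<in> sets M" and e: "e > 0"
  shows "\<exists>g :: 'a \<Rightarrow> real. continuous_on UNIV g \<and> integrable M g \<and> (\<integral>x. \<bar>indicator A x - g x\<bar> \<partial>M) < e"
proof -
  interpret finite_measure M by fact
  note [measurable_cong] = sets
  have [measurable]: "A \<in> sets borel" using A by (simp add: sets)
  have "\<exists>K\<in>{K. K \<subseteq> A \<and> compact K}. emeasure M A < emeasure M K + ennreal (e / 2)"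
  proof (rule SUP_approx_ennreal)
    show "emeasure M A = (SUP K\<in>{K. K \<subseteq> A \<and> compact K}. emeasure M K)"
      by (rule inner_regular[OF sets]) auto
  qed (use e in auto)
  then obtain K where K: "K \<subseteq> A" "compact K" "emeasure M A < emeasure M K + ennreal (e / 2)" by auto
  then have cl: "closed K" by (simp add: compact_imp_closed)
  then have [measurable]: "K \<in> sets borel" by simp
  have "ennreal (measure M A) < ennreal (measure M K + e / 2)"
    using K(3) e by (simp add: emeasure_eq_measure)
  then have mK: "measure M A < measure M K + e / 2" by (simp add: ennreal_less_iff)
  have AK: "(\<integral>x. \<bar>indicator A x - indicator K x\<bar> \<partial>M) < e / 2"
  proof -
    have "(\<integral>x. \<bar>indicator A x - indicator K x :: real\<bar> \<partial>M) = (\<integral>x. indicator A x - indicator K x \<partial>M)"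
      using K(1) by (intro Bochner_Integration.integral_cong) (auto split: split_indicator)
    also have "\<dots> = measure M A - measure M K"
      by (subst Bochner_Integration.integral_diff) (auto simp: sets integrable_indicator_iff less_top[symmetric])
    finally show ?thesis using mK by simp
  qed
  show ?thesis
  proof (cases "K = {}")
    \<comment> \<open>The empty set is treated apart: \<open>infdist x {}\<close> is 0 by
      convention, so the functions \<open>g n\<close> below would be constantly 1.\<close>
    case True then show ?thesis using AK e by (intro exI[of _ "\<lambda>_. 0"]) auto
  next
    case False
    define g where "g n x = max 0 (1 - real n * infdist x K)" for n x
    have g01: "0 \<le> g n x" "g n x \<le> 1" for n x by (auto simp: g_def infdist_nonneg)
    have cont: "continuous_on UNIV (g n)" for n
      unfolding g_def by (intro continuous_intros continuous_on_max continuous_on_infdist)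
    then have [measurable]: "g n \<in> borel_measurable borel" for n by (rule borel_measurable_continuous_onI)
    have lim: "(\<lambda>n. g n x) \<longlonglongrightarrow> indicator K x" for x
    proof (cases "x \<in> K")
      case True then show ?thesis by (simp add: g_def)
    next
      case nx: False
      then have "infdist x K > 0"
        using in_closed_iff_infdist_zero[OF cl False, of x] infdist_nonneg[of x K] by simp
      then obtain n0 where "real n0 * infdist x K > 1" using reals_Archimedean3 by blast
      then have "g n x = 0" if "n \<ge> n0" for n
        using that mult_right_mono[of "real n0" "real n" "infdist x K"] infdist_nonneg[of x K] by (auto simp: g_def)
      then show ?thesis using nx by (intro tendsto_eventually) (auto simp: eventually_sequentially)
    qed
    have "(\<lambda>n. \<integral>x. \<bar>indicator A x - g n x\<bar> \<partial>M) \<longlonglongrightarrow> (\<integral>x. \<bar>indicator A x - indicator K x\<bar> \<partial>M)"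
    proof (rule integral_dominated_convergence[where w="\<lambda>_. 1"])
      show "AE x in M. (\<lambda>n. \<bar>indicator A x - g n x\<bar>) \<longlonglongrightarrow> \<bar>indicator A x - indicator K x\<bar>"
        by (intro AE_I2 tendsto_intros lim)
      show "AE x in M. norm \<bar>indicator A x - g n x\<bar> \<le> 1" for n
        using g01[of n] by (auto split: split_indicator)
    qed auto
    from order_tendstoD(2)[OF this, of e] AK e
    obtain n where "(\<integral>x. \<bar>indicator A x - g n x\<bar> \<partial>M) < e" by (auto simp: eventually_sequentially)
    moreover have "integrable M (g n)"
      using g01[of n] by (intro integrable_const_bound[where B=1]) auto
    ultimately show ?thesis using cont by blast
  qed
qed

text \<open>Induction over integrable functions: the approximation property passes from indicators
  to multiples, sums and dominated limits.\<close>

lemma integrable_L1_approx_continuous: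
  fixes M :: "'a::{second_countable_topology, complete_space} measure" and f :: "'a \<Rightarrow> real"
  assumes fin: "finite_measure M" and sets: "sets M = sets borel" and f: "integrable M f" and e: "e > 0"
  shows "\<exists>g :: 'a \<Rightarrow> real. continuous_on UNIV g \<and> integrable M g \<and> (\<integral>x. \<bar>f x - g x\<bar> \<partial>M) < e"
  using f e
proof (induction arbitrary: e rule: integrable_induct)
  case (base A c)
  \<comment> \<open>Adding 1 keeps the denominator positive when \<open>c = 0\<close>.\<close>
  have "e / (\<bar>c\<bar> + 1) > 0" using base by simp
  from indicator_L1_approx_continuous[OF fin sets base(1) this]
  obtain g :: "'a \<Rightarrow> real" where g: "continuous_on UNIV g" "integrable M g"
    "(\<integral>x. \<bar>indicator A x - g x\<bar> \<partial>M) < e / (\<bar>c\<bar> + 1)" by auto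
  have "(\<integral>x. \<bar>indicator A x *\<^sub>R c - c * g x\<bar> \<partial>M) = (\<integral>x. \<bar>c\<bar> * \<bar>indicator A x - g x\<bar> \<partial>M)"
    by (intro Bochner_Integration.integral_cong) (auto simp: abs_mult[symmetric] algebra_simps)
  also have "\<dots> = \<bar>c\<bar> * (\<integral>x. \<bar>indicator A x - g x\<bar> \<partial>M)" by simp
  also have "\<dots> \<le> (\<bar>c\<bar> + 1) * (\<integral>x. \<bar>indicator A x - g x\<bar> \<partial>M)"
    by (intro mult_right_mono) auto
  also have "\<dots> < e" using g(3) by (simp add: field_simps)
  finally show ?case using g by (intro exI[of _ "\<lambda>x. c * g x"]) (auto intro: continuous_intros)
next
  case (add f1 f2)
  from add.IH(1)[of "e / 2"] add.prems
  obtain g1 :: "'a \<Rightarrow> real" where g1: "continuous_on UNIV g1" "integrable M g1" "(\<integral>x. \<bar>f1 x - g1 x\<bar> \<partial>M) < e / 2" by auto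
  from add.IH(2)[of "e / 2"] add.prems
  obtain g2 :: "'a \<Rightarrow> real" where g2: "continuous_on UNIV g2" "integrable M g2" "(\<integral>x. \<bar>f2 x - g2 x\<bar> \<partial>M) < e / 2" by auto
  have "(\<integral>x. \<bar>f1 x + f2 x - (g1 x + g2 x)\<bar> \<partial>M) \<le> (\<integral>x. \<bar>f1 x - g1 x\<bar> + \<bar>f2 x - g2 x\<bar> \<partial>M)"
    using add.hyps g1 g2 by (intro integral_mono) auto
  also have "\<dots> = (\<integral>x. \<bar>f1 x - g1 x\<bar> \<partial>M) + (\<integral>x. \<bar>f2 x - g2 x\<bar> \<partial>M)"
    using add.hyps g1 g2 by (intro Bochner_Integration.integral_add) auto
  also have "\<dots> < e" using g1(3) g2(3) by simp
  finally show ?case using g1 g2 by (intro exI[of _ "\<lambda>x. g1 x + g2 x"]) (auto intro: continuous_intros)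
next
  case (lim f s)
  have [measurable]: "f \<in> borel_measurable M" "s n \<in> borel_measurable M" for n using lim.hyps by auto
  have "(\<lambda>n. \<integral>x. \<bar>f x - s n x\<bar> \<partial>M) \<longlonglongrightarrow> (\<integral>x. \<bar>f x - f x\<bar> \<partial>M)"
  proof (rule integral_dominated_convergence[where w="\<lambda>x. 3 * \<bar>f x\<bar>"])
    show "integrable M (\<lambda>x. 3 * \<bar>f x\<bar>)" using lim.hyps by auto
    show "AE x in M. (\<lambda>n. \<bar>f x - s n x\<bar>) \<longlonglongrightarrow> \<bar>f x - f x\<bar>"
      using lim.hyps(2) by (intro AE_I2 tendsto_intros)
    \<comment> \<open>The induction rule provides \<open>norm (s n x) \<le> 2 * norm (f x)\<close>;
      the triangle inequality gives the factor 3.\<close>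
    show "AE x in M. norm \<bar>f x - s n x\<bar> \<le> 3 * \<bar>f x\<bar>" for n
    proof (rule AE_I2)
      fix x assume "x \<in> space M"
      then show "norm \<bar>f x - s n x\<bar> \<le> 3 * \<bar>f x\<bar>" using lim.hyps(3)[of x n] by auto
    qed
  qed auto
  from order_tendstoD(2)[OF this, of "e / 2"] lim.prems
  obtain n where n: "(\<integral>x. \<bar>f x - s n x\<bar> \<partial>M) < e / 2" by (auto simp: eventually_sequentially)
  from lim.IH[of "e / 2" n] lim.prems
  obtain g :: "'a \<Rightarrow> real" where g: "continuous_on UNIV g" "integrable M g" "(\<integral>x. \<bar>s n x - g x\<bar> \<partial>M) < e / 2" by auto
  have "(\<integral>x. \<bar>f x - g x\<bar> \<partial>M) \<le> (\<integral>x. \<bar>f x - s n x\<bar> + \<bar>s n x - g x\<bar> \<partial>M)"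
    using lim.hyps g by (intro integral_mono) auto
  also have "\<dots> = (\<integral>x. \<bar>f x - s n x\<bar> \<partial>M) + (\<integral>x. \<bar>s n x - g x\<bar> \<partial>M)"
    using lim.hyps g by (intro Bochner_Integration.integral_add) auto
  also have "\<dots> < e" using n g(3) by simp
  finally show ?case using g by blast
qed

text \<open>An L1-approximating sequence is clipped to \<open>[a, b]\<close>, which brings it no
  further from \<open>f\<close>, and a subsequence converges almost everywhere. Keeping the bounds
  matters: test functions have to stay above a positive constant to be raised to a negative
  power.\<close>

lemma AE_approx_continuous:
  fixes M :: "'a::{second_countable_topology, complete_space} measure" and f :: "'a \<Rightarrow> real"
  assumes fin: "finite_measure M" and sets: "sets M = sets borel"
    and f [measurable]: "f \<in> borel_measurable borel" and ab: "\<And>x. a \<le> f x" "\<And>x. f x \<le> b"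
  shows "\<exists>g :: nat \<Rightarrow> 'a \<Rightarrow> real. (\<forall>n. continuous_on UNIV (g n) \<and> (\<forall>x. a \<le> g n x \<and> g n x \<le> b)) \<and>
    (AE x in M. (\<lambda>n. g n x) \<longlonglongrightarrow> f x)"
proof -
  interpret finite_measure M by fact
  note [measurable_cong] = sets
  have ab': "a \<le> b" using ab[of undefined] by linarith
  have int: "integrable M f"
    by (rule integrable_const_bound[where B="max \<bar>a\<bar> \<bar>b\<bar>"])
      (use ab in \<open>auto intro!: AE_I2 simp: abs_le_iff le_max_iff_disj,
        (smt (verit) ab)+\<close>)
  have "\<exists>g :: 'a \<Rightarrow> real. continuous_on UNIV g \<and> integrable M g \<and> (\<integral>x. \<bar>f x - g x\<bar> \<partial>M) < 1 / Suc n" for n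
    by (rule integrable_L1_approx_continuous[OF fin sets int]) auto
  then obtain g :: "nat \<Rightarrow> 'a \<Rightarrow> real" where g: "\<And>n. continuous_on UNIV (g n)" "\<And>n. integrable M (g n)"
    "\<And>n. (\<integral>x. \<bar>f x - g n x\<bar> \<partial>M) < 1 / Suc n" by metis
  define k where "k n x = max a (min b (g n x))" for n x
  have k: "continuous_on UNIV (k n)" "a \<le> k n x" "k n x \<le> b" for n x
    unfolding k_def using g(1) ab' by (auto intro!: continuous_on_max continuous_on_min continuous_intros)
  have [measurable]: "k n \<in> borel_measurable borel" for n
    by (rule borel_measurable_continuous_onI[OF k(1)])
  have kint: "integrable M (k n)" for n
  proof (rule integrable_const_bound[where B="max \<bar>a\<bar> \<bar>b\<bar>"])
    show "AE x in M. norm (k n x) \<le> max \<bar>a\<bar> \<bar>b\<bar>"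
      using k(2,3)[of n] by (intro AE_I2) (smt (verit) real_norm_def)
  qed measurable
  have le: "\<bar>f x - k n x\<bar> \<le> \<bar>f x - g n x\<bar>" for n x
    using ab[of x] by (auto simp: k_def)
  have "(\<lambda>n. \<integral>x. norm (f x - k n x) \<partial>M) \<longlonglongrightarrow> 0"
  proof (rule real_tendsto_sandwich[OF _ _ tendsto_const LIMSEQ_inverse_real_of_nat])
    show "\<forall>\<^sub>F n in sequentially. 0 \<le> (\<integral>x. norm (f x - k n x) \<partial>M)" by simp
    have "(\<integral>x. norm (f x - k n x) \<partial>M) \<le> inverse (real (Suc n))" for n
    proof -
      have "(\<integral>x. norm (f x - k n x) \<partial>M) \<le> (\<integral>x. \<bar>f x - g n x\<bar> \<partial>M)"
        using int kint g(2) le by (intro integral_mono) auto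
      then show ?thesis using g(3)[of n] by (simp add: inverse_eq_divide)
    qed
    then show "\<forall>\<^sub>F n in sequentially. (\<integral>x. norm (f x - k n x) \<partial>M) \<le> inverse (real (Suc n))" by simp
  qed
  from tendsto_L1_AE_subseq[OF _ this] int kint
  obtain r where r: "AE x in M. (\<lambda>n. f x - k (r n) x) \<longlonglongrightarrow> 0" by auto
  have "AE x in M. (\<lambda>n. k (r n) x) \<longlonglongrightarrow> f x"
    using r
  proof eventually_elim
    case (elim x)
    from tendsto_diff[OF tendsto_const[of "f x"] this] show ?case by simp
  qed
  then show ?thesis using k by (intro exI[of _ "\<lambda>n. k (r n)"]) auto
qed

text \<open>Young's inequality for \<open>h * r\<close> and \<open>h powr (1 - N)\<close> with
  weights \<open>1 - 1 / N\<close> and \<open>1 / N\<close>. The right side is affine in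
  \<open>r\<close>, so after integration it involves a density only through the integral of
  \<open>h\<close> against it; equality holds for \<open>h = r powr (- 1 / N)\<close> when
  \<open>r > 0\<close>.\<close>

lemma powr_Young_tangent:
  fixes N r h :: real
  assumes N: "N > 1" and r: "r \<ge> 0" and h: "h > 0"
  shows "r powr (1 - 1 / N) \<le> 1 / N * h powr (1 - N) + (1 - 1 / N) * (h * r)"
proof (cases "r = 0")
  case False
  with r have r: "r > 0" by simp
  have "(h * r) powr (1 - 1 / N) * (h powr (1 - N)) powr (1 / N)
      \<le> (1 - 1 / N) * (h * r) + 1 / N * h powr (1 - N)"
    using N r h by (intro Youngs_inequality_0) auto
  moreover have "(h * r) powr (1 - 1 / N) * (h powr (1 - N)) powr (1 / N) = r powr (1 - 1 / N)"
  proof -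
    have e: "(1 - N) * (1 / N) = - (1 - 1 / N)" using N by (simp add: field_simps)
    have "(h * r) powr (1 - 1 / N) * (h powr (1 - N)) powr (1 / N) =
        r powr (1 - 1 / N) * (h powr (1 - 1 / N) * h powr (- (1 - 1 / N)))"
      unfolding powr_powr e using r h by (simp add: powr_mult)
    also have "h powr (1 - 1 / N) * h powr (- (1 - 1 / N)) = 1"
      unfolding powr_add[symmetric] using h by simp
    finally show ?thesis by simp
  qed
  ultimately show ?thesis by simp
qed (use N in simp)

text \<open>The convex function \<open>x powr (1 - N)\<close> lies above its tangent at
  \<open>y\<close>. This is the previous inequality for \<open>r = y powr - N\<close>, whose optimal
  \<open>h\<close> is \<open>y\<close>.\<close>

lemma powr_tangent_below:
  fixes N x y :: real
  assumes N: "N > 1" and x: "x > 0" and y: "y > 0"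
  shows "(N - 1) * (y powr (- N) * (y - x)) \<le> x powr (1 - N) - y powr (1 - N)"
proof -
  have "- N * (1 - 1 / N) = 1 - N" using N by (simp add: field_simps)
  then have *: "(y powr - N) powr (1 - 1 / N) = y powr (1 - N)" "y powr - N * y = y powr (1 - N)"
    using y powr_add[of y "- N" 1] by (simp_all only: powr_powr) simp
  have "y powr (1 - N) \<le> 1 / N * x powr (1 - N) + (1 - 1 / N) * (x * y powr - N)"
    using powr_Young_tangent[OF N, of "y powr - N" x] x by (simp add: *)
  then have "N * y powr (1 - N) \<le> N * (1 / N * x powr (1 - N) + (1 - 1 / N) * (x * y powr - N))"
    using N by (intro mult_left_mono) auto
  also have "\<dots> = x powr (1 - N) + (N - 1) * (x * y powr - N)" using N by (simp add: field_simps)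
  finally show ?thesis using *(2) by (simp add: algebra_simps)
qed

section \<open>Limits of measures with convergent entropy\<close>

text \<open>Integrate Young's inequality over \<open>B\<close>, outside which \<open>\<rho>\<close>
  vanishes. Since \<open>h\<close> is positive, its integral against the density is at most its
  integral against \<open>\<nu>\<close>. Thus the right side contains \<open>\<nu>\<close> itself,
  singular part included, and is accessible to weak convergence.\<close>

lemma integral_powr_le_of_decomposition:
  fixes \<mu> :: "'a::topological_space measure" and h :: "'a \<Rightarrow> real"
  assumes sets: "sets \<mu> = sets borel" and fin: "finite_measure \<nu>" and sets\<nu>: "sets \<nu> = sets \<mu>"
    and N: "N > 1" and B: "B \<in> sets \<mu>" "emeasure \<mu> B < \<infinity>" "emeasure \<nu> (space \<mu> - B) = 0"
    and d: "lebesgue_decomposition \<mu> \<nu> \<rho> \<nu>\<^sub>s"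
    and h: "h \<in> borel_measurable borel" and a: "0 < a" and h_ge: "\<And>x. a \<le> h x" and h_le: "\<And>x. h x \<le> b"
  shows "(\<integral>x. \<rho> x powr (1 - 1 / N) \<partial>\<mu>) \<le>
    1 / N * (\<integral>x. indicator B x * h x powr (1 - N) \<partial>\<mu>) + (1 - 1 / N) * (\<integral>x. h x \<partial>\<nu>)"
proof -
  interpret \<nu>: finite_measure \<nu> by fact
  have meas [measurable]: "\<rho> \<in> borel_measurable \<mu>" and nonneg: "\<And>x. \<rho> x \<ge> 0"
    and e: "\<And>A. A \<in> sets \<mu> \<Longrightarrow> emeasure \<nu> A = emeasure (density \<mu> (\<lambda>x. ennreal (\<rho> x))) A + emeasure \<nu>\<^sub>s A"
    using d by (auto simp: lebesgue_decomposition_def)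
  have [measurable]: "h \<in> borel_measurable \<mu>" "h \<in> borel_measurable \<nu>" "B \<in> sets \<mu>"
    using h B sets sets\<nu> by (auto cong: measurable_cong_sets)
  have hpos: "h x > 0" for x using a h_ge[of x] by linarith
  have i: "integrable \<mu> \<rho>" by (rule lebesgue_decomposition_integrable[OF fin sets\<nu> d])
  note conc = lebesgue_decomposition_concentrated[OF sets\<nu> B(1,3) d]
  have iB: "integrable \<mu> (\<lambda>x. indicator B x * a powr (1 - N))"
    using B by (auto simp: integrable_indicator_iff intro!: integrable_mult_left)
  have i1: "integrable \<mu> (\<lambda>x. indicator B x * h x powr (1 - N))"
  proof (rule Bochner_Integration.integrable_bound[OF iB])
    show "AE x in \<mu>. norm (indicator B x * h x powr (1 - N)) \<le> norm (indicator B x * a powr (1 - N))"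
      using a h_ge N by (auto intro!: AE_I2 powr_mono2' split: split_indicator)
  qed measurable
  have i2: "integrable \<mu> (\<lambda>x. h x * \<rho> x)"
  proof (rule Bochner_Integration.integrable_bound)
    show "integrable \<mu> (\<lambda>x. b * \<rho> x)" using i by simp
    show "AE x in \<mu>. norm (h x * \<rho> x) \<le> norm (b * \<rho> x)"
      using nonneg h_le hpos by (intro AE_I2) (simp add: abs_mult mult_right_mono less_imp_le abs_of_pos order_trans[OF _ abs_ge_self])
  qed measurable
  have "(\<integral>x. h x * \<rho> x \<partial>\<mu>) = enn2real (\<integral>\<^sup>+x. ennreal (\<rho> x) * ennreal (h x) \<partial>\<mu>)"
    using nonneg hpos by (subst integral_eq_nn_integral)
      (auto simp: ennreal_mult[symmetric] less_imp_le mult.commute)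
  also have "\<dots> = enn2real (\<integral>\<^sup>+x. ennreal (h x) \<partial>density \<mu> (\<lambda>x. ennreal (\<rho> x)))"
    by (subst nn_integral_density) auto
  also have "\<dots> \<le> enn2real (\<integral>\<^sup>+x. ennreal (h x) \<partial>\<nu>)"
  proof (rule enn2real_mono)
    have "density \<mu> (\<lambda>x. ennreal (\<rho> x)) \<le> \<nu>"
      using sets\<nu> by (subst le_measure) (auto simp: e)
    then show "(\<integral>\<^sup>+x. ennreal (h x) \<partial>density \<mu> (\<lambda>x. ennreal (\<rho> x))) \<le> (\<integral>\<^sup>+x. ennreal (h x) \<partial>\<nu>)"
      using sets\<nu> by (intro nn_integral_mono_measure) auto
    have "(\<integral>\<^sup>+x. ennreal (h x) \<partial>\<nu>) \<le> (\<integral>\<^sup>+x. ennreal b \<partial>\<nu>)"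
      using h_le by (intro nn_integral_mono) (auto intro: ennreal_leI)
    also have "\<dots> < \<infinity>" 
      by (auto simp: ennreal_mult_less_top \<nu>.emeasure_finite[unfolded infinity_ennreal_def less_top])
    finally show "(\<integral>\<^sup>+x. ennreal (h x) \<partial>\<nu>) < top" by simp
  qed
  also have "\<dots> = (\<integral>x. h x \<partial>\<nu>)"
    using hpos by (subst integral_eq_nn_integral) (auto simp: less_imp_le)
  finally have le: "(\<integral>x. h x * \<rho> x \<partial>\<mu>) \<le> (\<integral>x. h x \<partial>\<nu>)" .
  have "(\<integral>x. \<rho> x powr (1 - 1 / N) \<partial>\<mu>) \<le>
    (\<integral>x. 1 / N * (indicator B x * h x powr (1 - N)) + (1 - 1 / N) * (h x * \<rho> x) \<partial>\<mu>)"
  proof (rule integral_mono_AE)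
    show "integrable \<mu> (\<lambda>x. \<rho> x powr (1 - 1 / N))"
      using conc N by (intro integrable_powr_concentrated[OF B(1,2) i nonneg]) auto
    show "integrable \<mu> (\<lambda>x. 1 / N * (indicator B x * h x powr (1 - N)) + (1 - 1 / N) * (h x * \<rho> x))"
      using i1 i2 by (intro Bochner_Integration.integrable_add integrable_mult_right)
    show "AE x in \<mu>. \<rho> x powr (1 - 1 / N) \<le> 1 / N * (indicator B x * h x powr (1 - N)) + (1 - 1 / N) * (h x * \<rho> x)"
      using conc
    proof eventually_elim
      case (elim x)
      then show ?case
        using powr_Young_tangent[OF N nonneg hpos, of x x] N by (cases "x \<in> B") auto
    qed
  qed
  also have "\<dots> = 1 / N * (\<integral>x. indicator B x * h x powr (1 - N) \<partial>\<mu>) + (1 - 1 / N) * (\<integral>x. h x * \<rho> x \<partial>\<mu>)"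
    using i1 i2 by (subst Bochner_Integration.integral_add) auto
  also have "\<dots> \<le> 1 / N * (\<integral>x. indicator B x * h x powr (1 - N) \<partial>\<mu>) + (1 - 1 / N) * (\<integral>x. h x \<partial>\<nu>)"
    using le N by (intro add_left_mono mult_left_mono) auto
  finally show ?thesis .
qed

text \<open>The measures \<open>\<nu> n\<close> stand for the interpolations at times tending to 0,
  and \<open>\<rho>\<^sub>0\<close> for the density of their limit. Weak convergence concerns
  continuous functions; the aim is to pass the asymptotic bound \<open>c\<close> for the integrals
  of the merely Borel function \<open>f\<close> to the limit, with convergence of the power
  integrals as the extra input.\<close>

locale entropy_convergence =
  fixes \<mu> :: "'a::{second_countable_topology, complete_space} measure"
    and \<nu> :: "nat \<Rightarrow> 'a measure" and \<rho> :: "nat \<Rightarrow> 'a \<Rightarrow> real" and \<nu>\<^sub>s :: "nat \<Rightarrow> 'a measure"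
    and \<rho>\<^sub>0 f :: "'a \<Rightarrow> real" and N K c :: real and cs :: "nat \<Rightarrow> real" and B :: "'a set"
  assumes sets: "sets \<mu> = sets borel" and sets\<nu>: "\<And>n. sets (\<nu> n) = sets \<mu>"
    and fin: "\<And>n. finite_measure (\<nu> n)" and N: "N > 1"
    and B: "B \<in> sets \<mu>" "emeasure \<mu> B < \<infinity>" "\<And>n. emeasure (\<nu> n) (space \<mu> - B) = 0"
    and d: "\<And>n. lebesgue_decomposition \<mu> (\<nu> n) (\<rho> n) (\<nu>\<^sub>s n)"
    and \<rho>\<^sub>0: "integrable \<mu> \<rho>\<^sub>0" "\<And>x. \<rho>\<^sub>0 x \<ge> 0" "AE x in \<mu>. x \<notin> B \<longrightarrow> \<rho>\<^sub>0 x = 0"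
    and weak: "\<And>h :: 'a \<Rightarrow> real. continuous_on UNIV h \<Longrightarrow> bounded (range h) \<Longrightarrow>
      (\<lambda>n. \<integral>x. h x \<partial>\<nu> n) \<longlonglongrightarrow> (\<integral>x. \<rho>\<^sub>0 x * h x \<partial>\<mu>)"
    and powr_lim: "(\<lambda>n. \<integral>x. \<rho> n x powr (1 - 1 / N) \<partial>\<mu>) \<longlonglongrightarrow> (\<integral>x. \<rho>\<^sub>0 x powr (1 - 1 / N) \<partial>\<mu>)"
    and f: "f \<in> borel_measurable borel" "\<And>x. 0 \<le> f x" "\<And>x. f x \<le> K"
    and cs: "\<And>n. (\<integral>x. f x \<partial>\<nu> n) \<le> cs n" "cs \<longlonglongrightarrow> c"
begin

abbreviation "F0 \<equiv> \<integral>x. \<rho>\<^sub>0 x powr (1 - 1 / N) \<partial>\<mu>"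

lemma meas [measurable]: "f \<in> borel_measurable \<mu>" "\<rho>\<^sub>0 \<in> borel_measurable \<mu>" "B \<in> sets \<mu>"
  using f(1) \<rho>\<^sub>0(1) B sets by (auto cong: measurable_cong_sets)

lemma integrable_indicator_B: "integrable \<mu> (\<lambda>x. indicator B x * (r::real))"
  using B by (auto simp: integrable_indicator_iff intro!: integrable_mult_left)

text \<open>Test with \<open>h + \<delta> * f\<close> and let \<open>n\<close> tend to infinity. The
  integral of the negative power is independent of \<open>n\<close>, the \<open>h\<close>-part
  converges weakly, and the \<open>f\<close>-part is bounded by \<open>cs n\<close>; no continuity
  of \<open>f\<close> enters.\<close>

lemma continuous_test:
  assumes h: "continuous_on UNIV h" and a: "0 < a" and h_ge: "\<And>x. a \<le> h x" and h_le: "\<And>x. h x \<le> b"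
    and \<delta>: "\<delta> > 0"
  shows "F0 \<le> 1 / N * (\<integral>x. indicator B x * (h x + \<delta> * f x) powr (1 - N) \<partial>\<mu>) +
    (1 - 1 / N) * ((\<integral>x. \<rho>\<^sub>0 x * h x \<partial>\<mu>) + \<delta> * c)"
proof (rule LIMSEQ_le[OF powr_lim])
  have bh: "bounded (range h)"
    using h_ge h_le a by (intro boundedI[where B=b]) (auto simp: abs_le_iff, smt (verit))
  show "(\<lambda>n. 1 / N * (\<integral>x. indicator B x * (h x + \<delta> * f x) powr (1 - N) \<partial>\<mu>) +
        (1 - 1 / N) * ((\<integral>x. h x \<partial>\<nu> n) + \<delta> * cs n))
     \<longlonglongrightarrow> 1 / N * (\<integral>x. indicator B x * (h x + \<delta> * f x) powr (1 - N) \<partial>\<mu>) +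
        (1 - 1 / N) * ((\<integral>x. \<rho>\<^sub>0 x * h x \<partial>\<mu>) + \<delta> * c)"
    by (intro tendsto_intros weak h bh cs(2))
  have [measurable]: "h \<in> borel_measurable borel" by (rule borel_measurable_continuous_onI[OF h])
  have "(\<integral>x. \<rho> n x powr (1 - 1 / N) \<partial>\<mu>) \<le>
        1 / N * (\<integral>x. indicator B x * (h x + \<delta> * f x) powr (1 - N) \<partial>\<mu>) +
        (1 - 1 / N) * ((\<integral>x. h x \<partial>\<nu> n) + \<delta> * cs n)" for n
  proof -
    interpret \<nu>: finite_measure "\<nu> n" by (rule fin)
    have [measurable]: "h \<in> borel_measurable (\<nu> n)" "f \<in> borel_measurable (\<nu> n)"
      using f(1) sets\<nu> sets by (auto cong: measurable_cong_sets)
    have 1: "(\<integral>x. \<rho> n x powr (1 - 1 / N) \<partial>\<mu>) \<le>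
        1 / N * (\<integral>x. indicator B x * (h x + \<delta> * f x) powr (1 - N) \<partial>\<mu>) +
        (1 - 1 / N) * (\<integral>x. h x + \<delta> * f x \<partial>\<nu> n)"
    proof (rule integral_powr_le_of_decomposition[OF sets fin sets\<nu> N B d, where a=a and b="b + \<delta> * K"])
      show "(\<lambda>x. h x + \<delta> * f x) \<in> borel_measurable borel" using f(1) by measurable
      show "a \<le> h x + \<delta> * f x" for x using h_ge[of x] f(2)[of x] \<delta> by (simp add: add_increasing2)
      show "h x + \<delta> * f x \<le> b + \<delta> * K" for x
        using h_le[of x] f(3)[of x] \<delta> by (intro add_mono mult_left_mono) auto
    qed (fact a)
    have "integrable (\<nu> n) h"
      using h_ge h_le a by (intro \<nu>.integrable_const_bound[where B=b] AE_I2) (auto simp: abs_le_iff, smt (verit))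
    moreover have "integrable (\<nu> n) f"
      using f by (intro \<nu>.integrable_const_bound[where B=K]) auto
    ultimately have "(\<integral>x. h x + \<delta> * f x \<partial>\<nu> n) = (\<integral>x. h x \<partial>\<nu> n) + \<delta> * (\<integral>x. f x \<partial>\<nu> n)" by simp
    also have "\<dots> \<le> (\<integral>x. h x \<partial>\<nu> n) + \<delta> * cs n"
      using cs(1)[of n] \<delta> by (intro add_left_mono mult_left_mono) auto
    finally have "(1 - 1 / N) * (\<integral>x. h x + \<delta> * f x \<partial>\<nu> n) \<le> (1 - 1 / N) * ((\<integral>x. h x \<partial>\<nu> n) + \<delta> * cs n)"
      using N by (intro mult_left_mono) auto
    with 1 show ?thesis by linarith
  qed
  then show "\<exists>n0. \<forall>n\<ge>n0. (\<integral>x. \<rho> n x powr (1 - 1 / N) \<partial>\<mu>) \<le>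
        1 / N * (\<integral>x. indicator B x * (h x + \<delta> * f x) powr (1 - N) \<partial>\<mu>) +
        (1 - 1 / N) * ((\<integral>x. h x \<partial>\<nu> n) + \<delta> * cs n)" by blast
qed

text \<open>The inequality in \<open>continuous_test\<close> mentions only \<open>\<mu>\<close> and
  \<open>\<rho>\<^sub>0\<close>, no longer the measures \<open>\<nu> n\<close>. Hence
  \<open>h\<close> can be replaced by a limit of continuous functions that converge
  \<open>\<mu>\<close>-almost everywhere on \<open>B\<close>.\<close>

lemma Borel_test:
  assumes h: "h \<in> borel_measurable borel" and a: "0 < a" and h_ge: "\<And>x. a \<le> h x" and h_le: "\<And>x. h x \<le> b"
    and \<delta>: "\<delta> > 0"
  shows "F0 \<le> 1 / N * (\<integral>x. indicator B x * (h x + \<delta> * f x) powr (1 - N) \<partial>\<mu>) +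
    (1 - 1 / N) * ((\<integral>x. \<rho>\<^sub>0 x * h x \<partial>\<mu>) + \<delta> * c)"
proof -
  \<comment> \<open>Restricting \<open>\<mu>\<close> to \<open>B\<close> gives the finite measure
    that the approximation requires. Off \<open>B\<close> the first integrand and, almost
    everywhere, \<open>\<rho>\<^sub>0\<close> vanish.\<close>
  define M where "M = density \<mu> (indicator B)"
  have "emeasure M (space M) = emeasure \<mu> B"
    unfolding M_def by (subst emeasure_density) (auto simp flip: indicator_inter_arith intro!: arg_cong[where f="emeasure \<mu>"] dest: sets.sets_into_space[OF B(1), THEN subsetD])
  then have finM: "finite_measure M" using B(2) by (intro finite_measureI) auto
  have setsM: "sets M = sets borel" by (simp add: M_def sets)
  from AE_approx_continuous[OF finM setsM h h_ge h_le]
  obtain g where g: "\<And>n. continuous_on UNIV (g n)" "\<And>n x. a \<le> g n x" "\<And>n x. g n x \<le> b"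
    and lim: "AE x in M. (\<lambda>n. g n x) \<longlonglongrightarrow> h x" by blast
  have limB: "AE x in \<mu>. x \<in> B \<longrightarrow> (\<lambda>n. g n x) \<longlonglongrightarrow> h x"
    using lim unfolding M_def by (subst (asm) AE_density) (auto split: split_indicator_asm)
  have [measurable]: "g n \<in> borel_measurable \<mu>" "h \<in> borel_measurable \<mu>" for n
    using borel_measurable_continuous_onI[OF g(1)[of n]] h sets by (auto cong: measurable_cong_sets)
  have gpos: "g n x > 0" "h x > 0" for n x using a g(2)[of n x] h_ge[of x] by linarith+
  have 1: "(\<lambda>n. \<integral>x. indicator B x * (g n x + \<delta> * f x) powr (1 - N) \<partial>\<mu>) \<longlonglongrightarrow>
      (\<integral>x. indicator B x * (h x + \<delta> * f x) powr (1 - N) \<partial>\<mu>)"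
  proof (rule integral_dominated_convergence[OF _ _ integrable_indicator_B[of "a powr (1 - N)"]])
    show "AE x in \<mu>. (\<lambda>n. indicator B x * (g n x + \<delta> * f x) powr (1 - N)) \<longlonglongrightarrow>
      indicator B x * (h x + \<delta> * f x) powr (1 - N)"
      using limB
    proof eventually_elim
      case (elim x)
      have "h x + \<delta> * f x > 0" using gpos(2)[of x] f(2)[of x] \<delta> by (simp add: add_pos_nonneg)
      then show ?case using elim by (cases "x \<in> B") (auto intro!: tendsto_intros)
    qed
    show "AE x in \<mu>. norm (indicator B x * (g n x + \<delta> * f x) powr (1 - N)) \<le> indicator B x * a powr (1 - N)" for n
    proof (rule AE_I2)
      fix x
      have "a \<le> g n x + \<delta> * f x" using g(2)[of n x] f(2)[of x] \<delta> by (simp add: add_increasing2)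
      then show "norm (indicator B x * (g n x + \<delta> * f x) powr (1 - N)) \<le> indicator B x * a powr (1 - N)"
        using a N by (auto intro!: powr_mono2' split: split_indicator)
    qed
  qed measurable
  have 2: "(\<lambda>n. \<integral>x. \<rho>\<^sub>0 x * g n x \<partial>\<mu>) \<longlonglongrightarrow> (\<integral>x. \<rho>\<^sub>0 x * h x \<partial>\<mu>)"
  proof (rule integral_dominated_convergence[where w="\<lambda>x. \<rho>\<^sub>0 x * b"])
    show "AE x in \<mu>. (\<lambda>n. \<rho>\<^sub>0 x * g n x) \<longlonglongrightarrow> \<rho>\<^sub>0 x * h x"
      using limB \<rho>\<^sub>0(3)
    proof eventually_elim
      case (elim x)
      then show ?case by (cases "x \<in> B") (auto intro!: tendsto_intros)
    qed
    show "AE x in \<mu>. norm (\<rho>\<^sub>0 x * g n x) \<le> \<rho>\<^sub>0 x * b" for n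
      using g(3)[of n] gpos(1)[of n] \<rho>\<^sub>0(2) by (intro AE_I2) (auto simp: abs_mult less_imp_le mult_left_mono)
  qed (use \<rho>\<^sub>0(1) in auto)
  show ?thesis
  proof (rule LIMSEQ_le_const)
    show "(\<lambda>n. 1 / N * (\<integral>x. indicator B x * (g n x + \<delta> * f x) powr (1 - N) \<partial>\<mu>) +
        (1 - 1 / N) * ((\<integral>x. \<rho>\<^sub>0 x * g n x \<partial>\<mu>) + \<delta> * c)) \<longlonglongrightarrow>
      1 / N * (\<integral>x. indicator B x * (h x + \<delta> * f x) powr (1 - N) \<partial>\<mu>) +
        (1 - 1 / N) * ((\<integral>x. \<rho>\<^sub>0 x * h x \<partial>\<mu>) + \<delta> * c)"
      by (intro tendsto_intros 1 2)
  qed (use continuous_test[OF g(1) a g(2,3) \<delta>] in blast)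
qed

text \<open>The density \<open>\<rho>\<^sub>0\<close> may vanish, so the optimal test function \<open>\<rho>\<^sub>0 powr (- 1 / N)\<close> is truncated.\<close>

definition opt_test :: "nat \<Rightarrow> 'a \<Rightarrow> real" where
  "opt_test k x = (if \<rho>\<^sub>0 x = 0 then real (Suc k)
     else max (1 / real (Suc k)) (min (real (Suc k)) (\<rho>\<^sub>0 x powr (- 1 / N))))"

text \<open>The perturbed optimal test function. Where \<open>\<rho>\<^sub>0\<close> vanishes the
  optimal value is infinite, whereas \<open>0 powr (- 1 / N)\<close> is 0 by convention; the case
  distinctions on \<open>\<rho>\<^sub>0 x = 0\<close> below discard this value.\<close>

definition pert :: "real \<Rightarrow> 'a \<Rightarrow> real" where
  "pert \<delta> x = \<rho>\<^sub>0 x powr (- 1 / N) + \<delta> * f x"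

lemma opt_test_eventually:
  assumes "\<rho>\<^sub>0 x \<noteq> 0"
  shows "\<forall>\<^sub>F k in sequentially. opt_test k x = \<rho>\<^sub>0 x powr (- 1 / N)"
proof -
  define r where "r = \<rho>\<^sub>0 x powr (- 1 / N)"
  have "r > 0" using assms by (simp add: r_def)
  have "\<forall>\<^sub>F k in sequentially. real k > max r (1 / r)"
    using filterlim_real_sequentially unfolding filterlim_at_top_dense by blast
  then show ?thesis
  proof eventually_elim
    case (elim k)
    then have "1 / real (Suc k) \<le> r" using \<open>r > 0\<close> by (simp add: field_simps)
    with elim show ?case using assms unfolding opt_test_def r_def[symmetric] by simp
  qed
qed

text \<open>A lower bound uniform in \<open>k\<close>, needed to dominate negative powers of
  \<open>opt_test k\<close>.\<close>

lemma opt_test_ge: "min 1 (\<rho>\<^sub>0 x powr (- 1 / N)) \<le> opt_test k x" if "\<rho>\<^sub>0 x \<noteq> 0"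
proof -
  have "min 1 (\<rho>\<^sub>0 x powr (- 1 / N)) \<le> min (real (Suc k)) (\<rho>\<^sub>0 x powr (- 1 / N))"
    by (intro min.mono) auto
  then show ?thesis using that by (simp only: opt_test_def if_False le_max_iff_disj simp_thms)
qed

lemma integrable_powr: "integrable \<mu> (\<lambda>x. \<rho>\<^sub>0 x powr (1 - 1 / N))"
  using N \<rho>\<^sub>0 by (intro integrable_powr_concentrated[OF B(1,2)]) auto

text \<open>At the optimal test function both terms of Young's inequality reduce to
  \<open>\<rho>\<^sub>0 powr (1 - 1 / N)\<close>. The third identity shows that the derivative of
  \<open>h powr (1 - N)\<close> at this point is a multiple of
  \<open>\<rho>\<^sub>0\<close>.\<close>

lemma powr_N_simps:
  assumes "\<rho>\<^sub>0 x \<noteq> 0"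
  shows "\<rho>\<^sub>0 x * \<rho>\<^sub>0 x powr (- 1 / N) = \<rho>\<^sub>0 x powr (1 - 1 / N)"
    and "(\<rho>\<^sub>0 x powr (- 1 / N)) powr (1 - N) = \<rho>\<^sub>0 x powr (1 - 1 / N)"
    and "(\<rho>\<^sub>0 x powr (- 1 / N)) powr (- N) = \<rho>\<^sub>0 x"
proof -
  have pos: "\<rho>\<^sub>0 x > 0" using assms \<rho>\<^sub>0(2)[of x] by simp
  have e: "(- 1 / N) * (1 - N) = 1 - 1 / N" "(- 1 / N) * (- N) = 1" using N by (auto simp: field_simps)
  show "\<rho>\<^sub>0 x * \<rho>\<^sub>0 x powr (- 1 / N) = \<rho>\<^sub>0 x powr (1 - 1 / N)"
    using pos powr_add[of "\<rho>\<^sub>0 x" 1 "- 1 / N"] by simp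
  show "(\<rho>\<^sub>0 x powr (- 1 / N)) powr (1 - N) = \<rho>\<^sub>0 x powr (1 - 1 / N)"
    unfolding powr_powr e ..
  show "(\<rho>\<^sub>0 x powr (- 1 / N)) powr (- N) = \<rho>\<^sub>0 x"
    unfolding powr_powr e using pos by simp
qed

text \<open>The limit of \<open>Borel_test\<close> along the truncations \<open>opt_test k\<close>.
  For \<open>\<delta> = 0\<close> the two sides would agree, so what remains is a first-order
  statement in \<open>\<delta>\<close>.\<close>

lemma optimal_test:
  assumes \<delta>: "\<delta> > 0"
  shows "F0 \<le> 1 / N * (\<integral>x. indicator B x * (if \<rho>\<^sub>0 x = 0 then 0 else pert \<delta> x powr (1 - N)) \<partial>\<mu>) +
    (1 - 1 / N) * (F0 + \<delta> * c)"
proof (rule LIMSEQ_le_const)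
  have [measurable]: "opt_test k \<in> borel_measurable \<mu>" "pert \<delta> \<in> borel_measurable \<mu>" for k
    unfolding opt_test_def[abs_def] pert_def[abs_def] by measurable
  have ge: "1 / real (Suc k) \<le> opt_test k x" "opt_test k x \<le> real (Suc k)" for k x
  proof -
    have "1 / real (Suc k) \<le> 1" "1 \<le> real (Suc k)" by auto
    then have "1 / real (Suc k) \<le> real (Suc k)" by (rule order_trans)
    then show "1 / real (Suc k) \<le> opt_test k x" "opt_test k x \<le> real (Suc k)"
      unfolding opt_test_def by (auto simp del: of_nat_Suc simp: le_max_iff_disj min_le_iff_disj)
  qed
  have pos: "opt_test k x > 0" for k x using ge(1)[of k x] by (smt (verit) divide_pos_pos of_nat_0_less_iff zero_less_Suc)
  have bor: "opt_test k \<in> borel_measurable borel" for k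
    using sets by (subst measurable_cong_sets[OF sets[symmetric] refl]) measurable
  show "\<exists>n. \<forall>k\<ge>n. F0 \<le> 1 / N * (\<integral>x. indicator B x * (opt_test k x + \<delta> * f x) powr (1 - N) \<partial>\<mu>) +
    (1 - 1 / N) * ((\<integral>x. \<rho>\<^sub>0 x * opt_test k x \<partial>\<mu>) + \<delta> * c)"
    using Borel_test[OF bor _ ge \<delta>] by auto
  have 1: "(\<lambda>k. \<integral>x. \<rho>\<^sub>0 x * opt_test k x \<partial>\<mu>) \<longlonglongrightarrow> F0"
  proof (rule integral_dominated_convergence[where w="\<lambda>x. \<rho>\<^sub>0 x powr (1 - 1 / N) + \<rho>\<^sub>0 x"])
    show "AE x in \<mu>. (\<lambda>k. \<rho>\<^sub>0 x * opt_test k x) \<longlonglongrightarrow> \<rho>\<^sub>0 x powr (1 - 1 / N)"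
    proof (rule AE_I2)
      fix x
      show "(\<lambda>k. \<rho>\<^sub>0 x * opt_test k x) \<longlonglongrightarrow> \<rho>\<^sub>0 x powr (1 - 1 / N)"
      proof (cases "\<rho>\<^sub>0 x = 0")
        case False
        show ?thesis
          by (rule tendsto_eventually, use opt_test_eventually[OF False] in eventually_elim)
            (simp only: powr_N_simps(1)[OF False])
      qed simp
    qed
    show "AE x in \<mu>. norm (\<rho>\<^sub>0 x * opt_test k x) \<le> \<rho>\<^sub>0 x powr (1 - 1 / N) + \<rho>\<^sub>0 x" for k
    proof (rule AE_I2)
      fix x
      show "norm (\<rho>\<^sub>0 x * opt_test k x) \<le> \<rho>\<^sub>0 x powr (1 - 1 / N) + \<rho>\<^sub>0 x"
      proof (cases "\<rho>\<^sub>0 x = 0")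
        case False
        have "1 / real (Suc k) \<le> 1" by simp
        then have "opt_test k x \<le> \<rho>\<^sub>0 x powr (- 1 / N) + 1"
          unfolding opt_test_def if_not_P[OF False] using powr_ge_zero[of "\<rho>\<^sub>0 x" "- 1 / N"]
          by (intro max.boundedI min.coboundedI2) linarith+
        then have "\<rho>\<^sub>0 x * opt_test k x \<le> \<rho>\<^sub>0 x * (\<rho>\<^sub>0 x powr (- 1 / N) + 1)"
          using \<rho>\<^sub>0(2) by (intro mult_left_mono)
        then show ?thesis
          unfolding distrib_left powr_N_simps(1)[OF False]
          using \<rho>\<^sub>0(2)[of x] pos[of k x] by (simp add: abs_mult)
      qed simp
    qed
    show "integrable \<mu> (\<lambda>x. \<rho>\<^sub>0 x powr (1 - 1 / N) + \<rho>\<^sub>0 x)"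
      using integrable_powr \<rho>\<^sub>0(1) by simp
  qed measurable
  have 2: "(\<lambda>k. \<integral>x. indicator B x * (opt_test k x + \<delta> * f x) powr (1 - N) \<partial>\<mu>) \<longlonglongrightarrow>
    (\<integral>x. indicator B x * (if \<rho>\<^sub>0 x = 0 then 0 else pert \<delta> x powr (1 - N)) \<partial>\<mu>)"
  proof (rule integral_dominated_convergence[where w="\<lambda>x. indicator B x * 1 + \<rho>\<^sub>0 x powr (1 - 1 / N)"])
    show "integrable \<mu> (\<lambda>x. indicator B x * 1 + \<rho>\<^sub>0 x powr (1 - 1 / N))"
      using integrable_powr integrable_indicator_B[of 1] by (rule Bochner_Integration.integrable_add[rotated])
    show "AE x in \<mu>. (\<lambda>k. indicator B x * (opt_test k x + \<delta> * f x) powr (1 - N)) \<longlonglongrightarrow>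
      indicator B x * (if \<rho>\<^sub>0 x = 0 then 0 else pert \<delta> x powr (1 - N))"
    proof (rule AE_I2)
      fix x
      have "(\<lambda>k. (opt_test k x + \<delta> * f x) powr (1 - N)) \<longlonglongrightarrow>
        (if \<rho>\<^sub>0 x = 0 then 0 else pert \<delta> x powr (1 - N))"
      proof (cases "\<rho>\<^sub>0 x = 0")
        \<comment> \<open>Here the truncation equals \<open>real (Suc k)\<close>, which grows to the
          infinite optimal value, and its negative power tends to 0.\<close>
        case True
        have "filterlim (\<lambda>k. \<delta> * f x + real (Suc k)) at_top sequentially"
          by (intro filterlim_tendsto_add_at_top[OF tendsto_const]
              filterlim_compose[OF filterlim_real_sequentially filterlim_Suc])
        then have "(\<lambda>k. (\<delta> * f x + real (Suc k)) powr (1 - N)) \<longlonglongrightarrow> 0"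
          using N by (intro tendsto_neg_powr) auto
        then show ?thesis using True by (simp add: opt_test_def add.commute)
      next
        case False
        show ?thesis
          by (rule tendsto_eventually, use opt_test_eventually[OF False] in eventually_elim)
            (simp add: False pert_def)
      qed
      then show "(\<lambda>k. indicator B x * (opt_test k x + \<delta> * f x) powr (1 - N)) \<longlonglongrightarrow>
        indicator B x * (if \<rho>\<^sub>0 x = 0 then 0 else pert \<delta> x powr (1 - N))"
        by (rule tendsto_mult[OF tendsto_const])
    qed
    show "AE x in \<mu>. norm (indicator B x * (opt_test k x + \<delta> * f x) powr (1 - N))
      \<le> indicator B x * 1 + \<rho>\<^sub>0 x powr (1 - 1 / N)" for k
    proof (rule AE_I2)
      fix x
      have "(opt_test k x + \<delta> * f x) powr (1 - N) \<le> opt_test k x powr (1 - N)"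
        using pos[of k x] f(2)[of x] \<delta> N by (intro powr_mono2') auto
      also have "\<dots> \<le> 1 + \<rho>\<^sub>0 x powr (1 - 1 / N)"
      proof (cases "\<rho>\<^sub>0 x = 0")
        case True
        have "real (Suc k) powr (1 - N) \<le> 1 powr (1 - N)" using N by (intro powr_mono2') auto
        then show ?thesis using True by (simp add: opt_test_def)
      next
        case False
        \<comment> \<open>A lower bound for the base is an upper bound for its power with the
          negative exponent \<open>1 - N\<close>; the result is at most the larger of 1 and
          \<open>\<rho>\<^sub>0 x powr (1 - 1 / N)\<close>.\<close>
        have "opt_test k x powr (1 - N) \<le> min 1 (\<rho>\<^sub>0 x powr (- 1 / N)) powr (1 - N)"
          using opt_test_ge[OF False, of k] N False by (intro powr_mono2') auto
        also have "\<dots> \<le> 1 + \<rho>\<^sub>0 x powr (1 - 1 / N)"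
          using powr_N_simps(2)[OF False] by (auto simp: min_def)
        finally show ?thesis .
      qed
      finally show "norm (indicator B x * (opt_test k x + \<delta> * f x) powr (1 - N))
        \<le> indicator B x * 1 + \<rho>\<^sub>0 x powr (1 - 1 / N)"
        by (auto split: split_indicator)
    qed
  qed measurable
  show "(\<lambda>k. 1 / N * (\<integral>x. indicator B x * (opt_test k x + \<delta> * f x) powr (1 - N) \<partial>\<mu>) +
    (1 - 1 / N) * ((\<integral>x. \<rho>\<^sub>0 x * opt_test k x \<partial>\<mu>) + \<delta> * c)) \<longlonglongrightarrow>
    1 / N * (\<integral>x. indicator B x * (if \<rho>\<^sub>0 x = 0 then 0 else pert \<delta> x powr (1 - N)) \<partial>\<mu>) +
    (1 - 1 / N) * (F0 + \<delta> * c)"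
    by (intro tendsto_intros 1 2)
qed

text \<open>Convexity replaces differentiation in \<open>\<delta>\<close>: the tangent of
  \<open>h powr (1 - N)\<close> at the perturbed point bounds the first integral in
  \<open>optimal_test\<close> by \<open>F0\<close> minus \<open>(N - 1) * \<delta>\<close> times the
  integral claimed. The \<open>F0\<close> terms cancel and \<open>(N - 1) * \<delta>\<close> is
  divided out. The pointwise bound, uniform in \<open>\<delta>\<close>, serves as dominating
  function in the limit.\<close>

lemma perturbed_bound:
  assumes \<delta>: "\<delta> > 0"
  shows "(\<integral>x. (if \<rho>\<^sub>0 x = 0 then 0 else f x * pert \<delta> x powr (- N)) \<partial>\<mu>) \<le> c"
    and "integrable \<mu> (\<lambda>x. if \<rho>\<^sub>0 x = 0 then 0 else f x * pert \<delta> x powr (- N))"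
    and "norm (if \<rho>\<^sub>0 x = 0 then 0 else f x * pert \<delta> x powr (- N)) \<le> \<rho>\<^sub>0 x * f x"
proof -
  let ?H = "\<lambda>x. if \<rho>\<^sub>0 x = 0 then 0 else f x * pert \<delta> x powr (- N)"
  let ?G = "\<lambda>x. indicator B x * (if \<rho>\<^sub>0 x = 0 then 0 else pert \<delta> x powr (1 - N))"
  have [measurable]: "pert \<delta> \<in> borel_measurable \<mu>"
    unfolding pert_def[abs_def] by measurable
  have ge: "\<rho>\<^sub>0 x powr (- 1 / N) \<le> pert \<delta> x" for x using \<delta> f(2)[of x] by (simp add: pert_def)
  have bH: "norm (?H x) \<le> \<rho>\<^sub>0 x * f x" for x
  proof (cases "\<rho>\<^sub>0 x = 0")
    case False
    have "pert \<delta> x powr (- N) \<le> (\<rho>\<^sub>0 x powr (- 1 / N)) powr (- N)"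
      using False ge[of x] N by (intro powr_mono2') auto
    then have "f x * pert \<delta> x powr (- N) \<le> f x * \<rho>\<^sub>0 x"
      unfolding powr_N_simps(3)[OF False] using f(2) by (rule mult_left_mono)
    then show ?thesis using False f(2)[of x] by (simp add: abs_mult mult.commute[of "\<rho>\<^sub>0 x"])
  qed simp
  then show "norm (?H x) \<le> \<rho>\<^sub>0 x * f x" .
  have i\<rho>f: "integrable \<mu> (\<lambda>x. \<rho>\<^sub>0 x * f x)"
  proof (rule Bochner_Integration.integrable_bound)
    show "integrable \<mu> (\<lambda>x. \<rho>\<^sub>0 x * K)" using \<rho>\<^sub>0(1) by simp
    show "AE x in \<mu>. norm (\<rho>\<^sub>0 x * f x) \<le> norm (\<rho>\<^sub>0 x * K)"
      using \<rho>\<^sub>0(2) f by (intro AE_I2) (auto simp: abs_mult intro!: mult_left_mono order_trans[OF f(3)])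
  qed measurable
  show iH: "integrable \<mu> ?H"
  proof (rule Bochner_Integration.integrable_bound[OF i\<rho>f])
    show "AE x in \<mu>. norm (?H x) \<le> norm (\<rho>\<^sub>0 x * f x)"
      unfolding real_norm_def by (intro AE_I2 order_trans[OF bH[unfolded real_norm_def] abs_ge_self])
  qed measurable
  have bG: "?G x \<le> \<rho>\<^sub>0 x powr (1 - 1 / N)" for x
  proof (cases "\<rho>\<^sub>0 x = 0")
    case False
    have "pert \<delta> x powr (1 - N) \<le> (\<rho>\<^sub>0 x powr (- 1 / N)) powr (1 - N)"
      using False ge[of x] N by (intro powr_mono2') auto
    then show ?thesis unfolding powr_N_simps(2)[OF False] using False by (auto split: split_indicator)
  qed simp
  have iG: "integrable \<mu> ?G"
  proof (rule Bochner_Integration.integrable_bound[OF integrable_powr])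
    show "AE x in \<mu>. norm (?G x) \<le> norm (\<rho>\<^sub>0 x powr (1 - 1 / N))"
      using bG by (intro AE_I2) (auto simp: abs_mult)
  qed measurable
  have "(\<integral>x. ?G x + (N - 1) * \<delta> * ?H x \<partial>\<mu>) \<le> F0"
  proof (rule integral_mono_AE)
    show "integrable \<mu> (\<lambda>x. ?G x + (N - 1) * \<delta> * ?H x)"
      using iG iH by (intro Bochner_Integration.integrable_add integrable_mult_right)
    show "AE x in \<mu>. ?G x + (N - 1) * \<delta> * ?H x \<le> \<rho>\<^sub>0 x powr (1 - 1 / N)"
      using \<rho>\<^sub>0(3)
    proof eventually_elim
      case (elim x)
      show ?case
      proof (cases "\<rho>\<^sub>0 x = 0")
        case False
        then have "(N - 1) * (pert \<delta> x powr (- N) * (pert \<delta> x - \<rho>\<^sub>0 x powr (- 1 / N)))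
          \<le> (\<rho>\<^sub>0 x powr (- 1 / N)) powr (1 - N) - pert \<delta> x powr (1 - N)"
          using ge[of x] by (intro powr_tangent_below[OF N]) (auto intro: less_le_trans[OF _ ge])
        moreover have "pert \<delta> x - \<rho>\<^sub>0 x powr (- 1 / N) = \<delta> * f x" by (simp add: pert_def)
        ultimately show ?thesis using False elim unfolding powr_N_simps(2)[OF False]
          by (simp add: algebra_simps)
      qed simp
    qed
  qed (rule integrable_powr)
  then have "integral\<^sup>L \<mu> ?G + (N - 1) * \<delta> * integral\<^sup>L \<mu> ?H \<le> F0"
    using iG iH by (subst (asm) Bochner_Integration.integral_add) auto
  then have "N * F0 - integral\<^sup>L \<mu> ?G \<ge> (N - 1) * F0 + (N - 1) * \<delta> * integral\<^sup>L \<mu> ?H" by (simp add: algebra_simps)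
  moreover have "N * F0 \<le> integral\<^sup>L \<mu> ?G + (N - 1) * (F0 + \<delta> * c)"
  proof -
    have "N * (1 / N * g + (1 - 1 / N) * C) = g + (N - 1) * C" for g C
      using N by (simp add: field_simps)
    then show ?thesis using mult_left_mono[OF optimal_test[OF \<delta>], of N] N by simp
  qed
  ultimately have "(N - 1) * \<delta> * integral\<^sup>L \<mu> ?H \<le> (N - 1) * \<delta> * c" by (simp add: algebra_simps)
  then show "integral\<^sup>L \<mu> ?H \<le> c" using N \<delta> by simp
qed

text \<open>As \<open>\<delta>\<close> tends to 0, \<open>pert \<delta> x powr (- N)\<close> tends
  to \<open>\<rho>\<^sub>0 x\<close> wherever this is nonzero, and \<open>\<rho>\<^sub>0 * K\<close>
  dominates the integrands.\<close>

theorem limit_bound: "(\<integral>x. \<rho>\<^sub>0 x * f x \<partial>\<mu>) \<le> c"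
proof (rule LIMSEQ_le_const2)
  have [measurable]: "pert \<delta> \<in> borel_measurable \<mu>" for \<delta>
    unfolding pert_def[abs_def] by measurable
  let ?H = "\<lambda>n x. if \<rho>\<^sub>0 x = 0 then 0 else f x * pert (1 / real (Suc n)) x powr (- N)"
  show "\<exists>n0. \<forall>n\<ge>n0. (\<integral>x. ?H n x \<partial>\<mu>) \<le> c"
    using perturbed_bound(1)[of "1 / real (Suc n)" for n] by auto
  show "(\<lambda>n. \<integral>x. ?H n x \<partial>\<mu>) \<longlonglongrightarrow> (\<integral>x. \<rho>\<^sub>0 x * f x \<partial>\<mu>)"
  proof (rule integral_dominated_convergence[where w="\<lambda>x. \<rho>\<^sub>0 x * K"])
    show "integrable \<mu> (\<lambda>x. \<rho>\<^sub>0 x * K)" using \<rho>\<^sub>0(1) by simp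
    show "AE x in \<mu>. norm (?H n x) \<le> \<rho>\<^sub>0 x * K" for n
    proof (rule AE_I2)
      fix x
      have "norm (?H n x) \<le> \<rho>\<^sub>0 x * f x" by (rule perturbed_bound(3)) simp
      also have "\<dots> \<le> \<rho>\<^sub>0 x * K" using \<rho>\<^sub>0(2) f(3) by (intro mult_left_mono)
      finally show "norm (?H n x) \<le> \<rho>\<^sub>0 x * K" .
    qed
    show "AE x in \<mu>. (\<lambda>n. ?H n x) \<longlonglongrightarrow> \<rho>\<^sub>0 x * f x"
    proof (rule AE_I2)
      fix x
      show "(\<lambda>n. ?H n x) \<longlonglongrightarrow> \<rho>\<^sub>0 x * f x"
      proof (cases "\<rho>\<^sub>0 x = 0")
        case False
        have "(\<lambda>n. 1 / real (Suc n)) \<longlonglongrightarrow> 0"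
          using LIMSEQ_inverse_real_of_nat by (simp add: inverse_eq_divide)
        then have "(\<lambda>n. pert (1 / real (Suc n)) x) \<longlonglongrightarrow> \<rho>\<^sub>0 x powr (- 1 / N) + 0 * f x"
          unfolding pert_def by (intro tendsto_intros)
        then have "(\<lambda>n. f x * pert (1 / real (Suc n)) x powr (- N)) \<longlonglongrightarrow> f x * (\<rho>\<^sub>0 x powr (- 1 / N)) powr (- N)"
          using False by (intro tendsto_intros) auto
        then show ?thesis using False by (simp only: powr_N_simps(3)[OF False] if_False mult.commute)
      qed simp
    qed
  qed measurable
qed

end

section \<open>Slopes and potentials\<close>

text \<open>The supremum at a fixed scale, before the infimum over radii that gives the ascending
  slope. Over an empty punctured ball it is 0, as the supremum is taken in
  \<open>ennreal\<close>.\<close>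

definition slope_ball :: "('a::metric_space \<Rightarrow> real) \<Rightarrow> real \<Rightarrow> 'a \<Rightarrow> ennreal" where
  "slope_ball \<phi> r x = (SUP y\<in>ball x r - {x}. ennreal (max 0 (\<phi> y - \<phi> x) / dist y x))"

lemma ascending_slope_eq_INF: "ascending_slope \<phi> x = (INF r\<in>{0<..}. slope_ball \<phi> r x)"
  unfolding ascending_slope_def slope_ball_def by (rule Limsup_at)

lemma slope_ball_mono: "r \<le> s \<Longrightarrow> slope_ball \<phi> r x \<le> slope_ball \<phi> s x"
  unfolding slope_ball_def by (intro SUP_subset_mono) auto

lemma ascending_slope_le: "r > 0 \<Longrightarrow> ascending_slope \<phi> x \<le> slope_ball \<phi> r x"
  unfolding ascending_slope_eq_INF by (intro INF_lower) auto

lemma slope_ball_tendsto: "(\<lambda>k. slope_ball \<phi> (1 / real (Suc k)) x) \<longlonglongrightarrow> ascending_slope \<phi> x"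
proof -
  have "decseq (\<lambda>k. slope_ball \<phi> (1 / real (Suc k)) x)"
    by (intro decseq_SucI slope_ball_mono) (simp add: field_simps)
  then have "(\<lambda>k. slope_ball \<phi> (1 / real (Suc k)) x) \<longlonglongrightarrow> (INF k. slope_ball \<phi> (1 / real (Suc k)) x)"
    by (rule LIMSEQ_INF)
  also have "(INF k. slope_ball \<phi> (1 / real (Suc k)) x) = ascending_slope \<phi> x"
  proof (rule antisym)
    show "(INF k. slope_ball \<phi> (1 / real (Suc k)) x) \<le> ascending_slope \<phi> x"
      unfolding ascending_slope_eq_INF
    proof (rule INF_mono)
      fix r :: real assume "r \<in> {0<..}"
      then obtain k where "1 / real (Suc k) < r" using nat_approx_posE by auto
      then show "\<exists>k\<in>UNIV. slope_ball \<phi> (1 / real (Suc k)) x \<le> slope_ball \<phi> r x"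
        by (intro bexI[of _ k] slope_ball_mono) auto
    qed
    show "ascending_slope \<phi> x \<le> (INF k. slope_ball \<phi> (1 / real (Suc k)) x)"
      by (intro INF_greatest ascending_slope_le) simp
  qed
  finally show ?thesis .
qed

text \<open>For fixed \<open>y\<close> the quotient is continuous in \<open>x\<close> on
  \<open>ball y r - {y}\<close>. The strict superlevel sets are therefore unions over
  \<open>y\<close> of open sets, and even an uncountable such union is open.\<close>

lemma borel_measurable_slope_ball:
  fixes \<phi> :: "'a::metric_space \<Rightarrow> real"
  assumes \<phi>: "continuous_on UNIV \<phi>"
  shows "slope_ball \<phi> r \<in> borel_measurable borel"
proof (rule borel_measurableI_greater)
  fix a :: ennreal
  define Q where "Q y x = ennreal (max 0 (\<phi> y - \<phi> x) / dist y x)" for x y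
  have "{x \<in> space borel. a < slope_ball \<phi> r x} = (\<Union>y. Q y -` {a<..} \<inter> (ball y r - {y}))"
    by (auto simp: slope_ball_def less_SUP_iff Q_def dist_commute)
  also have "open \<dots>"
  proof (intro open_UN ballI)
    fix y :: 'a
    have "continuous_on (ball y r - {y}) (Q y)"
      unfolding Q_def
      by (intro continuous_on_ennreal continuous_on_divide continuous_on_max continuous_intros
          continuous_on_subset[OF \<phi>]) auto
    moreover have "open (ball y r - {y})" by (intro open_Diff) auto
    ultimately show "open (Q y -` {a<..} \<inter> (ball y r - {y}))"
      using continuous_on_open_vimage[of "ball y r - {y}" "Q y"] open_greaterThan[of a] by auto
  qed
  finally show "{x \<in> space borel. a < slope_ball \<phi> r x} \<in> sets borel" by simp
qed

lemma borel_measurable_ascending_slope: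
  fixes \<phi> :: "'a::metric_space \<Rightarrow> real"
  assumes "continuous_on UNIV \<phi>"
  shows "ascending_slope \<phi> \<in> borel_measurable borel"
  by (rule borel_measurable_LIMSEQ_order[OF slope_ball_tendsto borel_measurable_slope_ball[OF assms]])

lemma slope_ball_le_lipschitz:
  assumes "L-lipschitz_on S \<phi>" "ball x r \<subseteq> S" "r > 0"
  shows "slope_ball \<phi> r x \<le> ennreal L"
  unfolding slope_ball_def
proof (rule SUP_least)
  fix y assume y: "y \<in> ball x r - {x}"
  have "dist (\<phi> y) (\<phi> x) \<le> L * dist y x"
    using y assms by (intro lipschitz_onD[OF assms(1)]) auto
  moreover have "0 \<le> L" using assms(1) by (rule lipschitz_on_nonneg)
  ultimately have "max 0 (\<phi> y - \<phi> x) \<le> L * dist y x" by (auto simp: dist_real_def)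
  then show "ennreal (max 0 (\<phi> y - \<phi> x) / dist y x) \<le> ennreal L"
    using y by (intro ennreal_leI) (auto simp: divide_le_eq)
qed

lemma lipschitz_on_bounded_sets_continuous:
  fixes \<phi> :: "'a::metric_space \<Rightarrow> real"
  assumes "lipschitz_on_bounded_sets \<phi>"
  shows "continuous_on UNIV \<phi>"
proof -
  have "isCont \<phi> x" for x
  proof -
    obtain L where "L-lipschitz_on (ball x 1) \<phi>"
      using assms by (auto simp: lipschitz_on_bounded_sets_def)
    then have "continuous_on (ball x 1) \<phi>" by (rule lipschitz_on_continuous_on)
    then show ?thesis by (simp add: continuous_on_eq_continuous_at)
  qed
  then show ?thesis by (simp add: continuous_at_imp_continuous_on)
qed

section \<open>Convexity of the cost and slopes of potentials\<close>

lemma powr_diff_le_tangent: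
  fixes p a b :: real
  assumes p: "p > 1" and a: "a \<ge> 0" and b: "b \<ge> 0"
  shows "a powr p - b powr p \<le> p * a powr (p - 1) * (a - b)"
proof -
  \<comment> \<open>Convexity of the \<open>p\<close>-th power, in the form of its tangent at
    \<open>a\<close>, is Young's inequality for \<open>b\<close> and \<open>a powr (p - 1)\<close>
    with exponents \<open>p\<close> and \<open>p / (p - 1)\<close>.\<close>
  have "b * a powr (p - 1) \<le> b powr p / p + (a powr (p - 1)) powr (p / (p - 1)) / (p / (p - 1))"
    using p a b by (intro Youngs_inequality) (auto simp: field_simps)
  also have "(a powr (p - 1)) powr (p / (p - 1)) = a powr p" using p by (simp add: powr_powr)
  finally have "p * (b * a powr (p - 1)) \<le> p * (b powr p / p + a powr p / (p / (p - 1)))"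
    using p by (intro mult_left_mono) auto
  also have "\<dots> = b powr p + (p - 1) * a powr p" using p by (simp add: field_simps)
  finally have "p * (b * a powr (p - 1)) \<le> b powr p + (p - 1) * a powr p" .
  moreover have "a powr (p - 1) * a = a powr p"
    using powr_mult_base[OF a, of "p - 1"] by (simp add: mult.commute)
  ultimately show ?thesis by (simp add: algebra_simps)
qed

text \<open>The function \<open>z \<mapsto> cost p z y - b\<close> touches \<open>\<phi>\<close>
  from above at \<open>x\<close>, so the ascent of \<open>\<phi>\<close> from \<open>x\<close> is at
  most that of the cost. By the tangent inequality at \<open>z\<close>, its difference quotients
  over the ball of radius \<open>r\<close> are at most \<open>(dist x y + r) powr (p - 1)\<close>;
  then \<open>r\<close> tends to 0.\<close>

lemma ascending_slope_le_potential:
  fixes \<phi> :: "'a::metric_space \<Rightarrow> real"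
  assumes p: "p > 1" and le: "\<And>z. \<phi> z \<le> cost p z y - b" and eq: "\<phi> x = cost p x y - b"
  shows "ascending_slope \<phi> x \<le> ennreal (dist x y powr (p - 1))"
proof (rule LIMSEQ_le_const)
  have b: "slope_ball \<phi> r x \<le> ennreal ((dist x y + r) powr (p - 1))" if r: "r > 0" for r
    unfolding slope_ball_def
  proof (intro SUP_least ennreal_leI)
    fix z assume z: "z \<in> ball x r - {x}"
    define C where "C = (dist x y + r) powr (p - 1)"
    have tri: "dist z y \<le> dist x y + dist z x" by (metis add.commute dist_commute dist_triangle)
    have C: "dist z y powr (p - 1) \<le> C" unfolding C_def
      using tri z p by (intro powr_mono2) (auto simp: dist_commute)
    have "\<phi> z - \<phi> x \<le> (dist z y powr p - dist x y powr p) / p"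
      using le[of z] eq by (simp add: cost_def diff_divide_distrib)
    also have "\<dots> \<le> dist z y powr (p - 1) * (dist z y - dist x y)"
      using powr_diff_le_tangent[OF p, of "dist z y" "dist x y"] p by (simp add: divide_le_eq mult.commute mult.left_commute)
    also have "\<dots> \<le> dist z y powr (p - 1) * dist z x"
      using tri by (intro mult_left_mono) auto
    also have "\<dots> \<le> C * dist z x" using C by (intro mult_right_mono) auto
    finally have "max 0 (\<phi> z - \<phi> x) \<le> C * dist z x" by (simp add: C_def)
    then show "max 0 (\<phi> z - \<phi> x) / dist z x \<le> C" using z by (simp add: divide_le_eq)
  qed
  show "(\<lambda>k. ennreal ((dist x y + 1 / real (Suc k)) powr (p - 1))) \<longlonglongrightarrow> ennreal (dist x y powr (p - 1))"
  proof (intro tendsto_ennrealI tendsto_powr')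
    have "(\<lambda>k. 1 / real (Suc k)) \<longlonglongrightarrow> 0"
      using LIMSEQ_inverse_real_of_nat by (simp add: inverse_eq_divide)
    from tendsto_add[OF tendsto_const[of "dist x y"] this]
    show "(\<lambda>k. dist x y + 1 / real (Suc k)) \<longlonglongrightarrow> dist x y" by simp
    show "(\<lambda>k. p - 1) \<longlonglongrightarrow> p - 1" by (rule tendsto_const)
    \<comment> \<open>The distance may be 0; continuity of the power at 0 uses the positive
      exponent.\<close>
    show "dist x y \<noteq> 0 \<or> 0 < p - 1 \<and> (\<forall>\<^sub>F k in sequentially. 0 \<le> dist x y + 1 / real (Suc k))"
      using p by (intro disjI2 conjI always_eventually) auto
  qed
  show "\<exists>n. \<forall>k\<ge>n. ascending_slope \<phi> x \<le> ennreal ((dist x y + 1 / real (Suc k)) powr (p - 1))"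
    using order_trans[OF ascending_slope_le b] by auto
qed

text \<open>Look back from the intermediate point \<open>z\<close> to \<open>x\<close>:
  \<open>\<phi> x - \<phi> z\<close> is at least the decrease of the cost from \<open>x\<close> to
  \<open>z\<close>, which the tangent inequality at \<open>z\<close> bounds below by
  \<open>t * dist x y * dist z y powr (p - 1)\<close>. The condition on \<open>r\<close> puts
  \<open>x\<close> into the ball around \<open>z\<close>. For \<open>x = y\<close> the left side is
  0.\<close>

lemma slope_ball_ge_potential:
  fixes \<phi> :: "'a::metric_space \<Rightarrow> real"
  assumes p: "p > 1" and le: "\<phi> z \<le> cost p z y - b" and eq: "\<phi> x = cost p x y - b"
    and t: "0 < t" "t < 1" and z: "dist x z = t * dist x y" "dist z y = (1 - t) * dist x y"
    and r: "t * dist x y < r"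
  shows "ennreal ((1 - t) powr (p - 1) * dist x y powr (p - 1)) \<le> slope_ball \<phi> r z"
proof (cases "x = y")
  case False
  define d where "d = dist x y"
  have d: "d > 0" using False by (simp add: d_def)
  have zx: "dist x z = t * d" "dist z y = (1 - t) * d" using z by (auto simp: d_def)
  have "((1 - t) * d) powr p - d powr p \<le> p * ((1 - t) * d) powr (p - 1) * ((1 - t) * d - d)"
    using d t by (intro powr_diff_le_tangent[OF p]) auto
  also have "\<dots> = - (p * (t * d * ((1 - t) powr (p - 1) * d powr (p - 1))))"
  proof -
    have "((1 - t) * d) powr (p - 1) = (1 - t) powr (p - 1) * d powr (p - 1)"
      by (rule powr_mult)
    then show ?thesis by (simp add: algebra_simps)
  qed
  finally have "t * d * ((1 - t) powr (p - 1) * d powr (p - 1)) \<le> (d powr p - ((1 - t) * d) powr p) / p"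
    using p by (simp add: field_simps)
  also have "\<dots> \<le> \<phi> x - \<phi> z"
    using le eq unfolding cost_def zx d_def[symmetric] by (simp add: diff_divide_distrib)
  finally have "(1 - t) powr (p - 1) * d powr (p - 1) \<le> max 0 (\<phi> x - \<phi> z) / dist x z"
    unfolding zx using d t by (simp add: pos_le_divide_eq mult.commute le_max_iff_disj)
  then have "ennreal ((1 - t) powr (p - 1) * d powr (p - 1)) \<le> ennreal (max 0 (\<phi> x - \<phi> z) / dist x z)"
    by (rule ennreal_leI)
  also have "\<dots> \<le> slope_ball \<phi> r z"
  proof -
    have "dist z x = t * d" "t * d < r" "t * d > 0"
      using zx(1) r d t by (simp_all add: d_def dist_commute)
    then have "x \<in> ball z r - {z}" by auto
    then show ?thesis unfolding slope_ball_def by (rule SUP_upper)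
  qed
  finally show ?thesis by (simp add: d_def)
qed (use p in simp)

section \<open>Supports, sigma-finiteness and Kantorovich duality\<close>

lemma measure_supp_null:
  fixes \<nu> :: "'a::second_countable_topology measure"
  assumes sets: "sets \<nu> = sets borel" and B: "measure_supp \<nu> \<subseteq> B" "closed B"
  shows "emeasure \<nu> (- B) = 0"
proof -
  obtain \<B> :: "'a set set" where \<B>: "countable \<B>" "topological_basis \<B>"
    using ex_countable_basis by blast
  \<comment> \<open>Each point off the support has a null neighbourhood, hence a null basis set
    around it. Countably many basis sets suffice, so their union stays null.\<close>
  define \<C> where "\<C> = {V \<in> \<B>. emeasure \<nu> V = 0}"
  have "\<Union>\<C> \<in> null_sets \<nu>"
  proof (rule null_sets_UN'[of \<C> "\<lambda>V. V", simplified])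
    show "countable \<C>" using \<B>(1) by (simp add: \<C>_def)
    show "V \<in> null_sets \<nu>" if "V \<in> \<C>" for V
      using that topological_basis_open[OF \<B>(2)] sets by (auto simp: \<C>_def null_sets_def)
  qed
  moreover have "- B \<subseteq> \<Union>\<C>"
  proof
    fix x assume "x \<in> - B"
    then have "x \<notin> measure_supp \<nu>" using B by auto
    then obtain U where U: "open U" "x \<in> U" "emeasure \<nu> U = 0" by (auto simp: measure_supp_def)
    then obtain V where V: "V \<in> \<B>" "x \<in> V" "V \<subseteq> U" using topological_basisE[OF \<B>(2)] by metis
    then have "emeasure \<nu> V \<le> emeasure \<nu> U" using U sets by (intro emeasure_mono) auto
    then show "x \<in> \<Union>\<C>" using V U by (auto simp: \<C>_def)
  qed
  ultimately have "- B \<in> null_sets \<nu>" using B(2) sets by (auto intro: null_sets_subset)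
  then show ?thesis by auto
qed

lemma locally_finite_sigma_finite:
  fixes \<mu> :: "'a::second_countable_topology measure"
  assumes "locally_finite_borel_measure \<mu>"
  shows "sigma_finite_measure \<mu>"
proof
  have sets: "sets \<mu> = sets borel" and lf: "\<And>x. \<exists>U. open U \<and> x \<in> U \<and> emeasure \<mu> U < \<infinity>"
    using assms by (auto simp: locally_finite_borel_measure_def)
  obtain \<B> :: "'a set set" where \<B>: "countable \<B>" "topological_basis \<B>"
    using ex_countable_basis by blast
  define \<C> where "\<C> = {V \<in> \<B>. emeasure \<mu> V < \<infinity>}"
  have "x \<in> \<Union>\<C>" for x
  proof -
    obtain U where U: "open U" "x \<in> U" "emeasure \<mu> U < \<infinity>" using lf by blast
    then obtain V where V: "V \<in> \<B>" "x \<in> V" "V \<subseteq> U" using topological_basisE[OF \<B>(2)] by metis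
    then have "emeasure \<mu> V \<le> emeasure \<mu> U" using U sets by (intro emeasure_mono) auto
    then show "x \<in> \<Union>\<C>" using V U by (auto simp: \<C>_def)
  qed
  then have "\<Union>\<C> = UNIV" by blast
  moreover have "space \<mu> = UNIV" using sets_eq_imp_space_eq[OF sets] by simp
  moreover have "\<C> \<subseteq> sets \<mu>"
    using topological_basis_open[OF \<B>(2)] sets by (auto simp: \<C>_def)
  ultimately show "\<exists>A. countable A \<and> A \<subseteq> sets \<mu> \<and> \<Union> A = space \<mu> \<and> (\<forall>a\<in>A. emeasure \<mu> a \<noteq> \<infinity>)"
    using \<B>(1) by (intro exI[of _ \<C>] conjI) (simp_all add: \<C>_def less_top[symmetric])
qed

text \<open>As an infimum of continuous functions the transform is upper semicontinuous: its strict
  sublevel sets are unions of open sets, one for each \<open>x\<close>.\<close>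

lemma borel_measurable_c_transform:
  fixes \<phi> :: "'a::metric_space \<Rightarrow> real"
  assumes p: "p > 0"
  shows "c_transform p (\<lambda>x. ereal (\<phi> x)) \<in> borel_measurable borel"
proof (rule borel_measurableI_less)
  fix a :: ereal
  have "{y \<in> space borel. c_transform p (\<lambda>x. ereal (\<phi> x)) y < a} =
      (\<Union>x. (\<lambda>y. ereal (cost p x y - \<phi> x)) -` {..<a})"
    by (auto simp: c_transform_def INF_less_iff)
  also have "open \<dots>"
  proof (intro open_UN ballI open_vimage)
    fix x
    show "continuous_on UNIV (\<lambda>y. ereal (cost p x y - \<phi> x))"
      unfolding cost_def using p
      by (intro continuous_on_ereal continuous_intros continuous_on_powr') auto
  qed auto
  finally show "{y \<in> space borel. c_transform p (\<lambda>x. ereal (\<phi> x)) y < a} \<in> sets borel" by simp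
qed

text \<open>In \<open>ereal\<close> the difference \<open>\<infinity> - \<infinity>\<close> is
  infinite, so a finite value of the extended integral forces both parts to be finite; then
  \<open>g\<close> is real almost everywhere.\<close>

lemma ereal_integral_eq_real:
  assumes [measurable]: "g \<in> borel_measurable M" and lt: "\<And>x. g x \<noteq> \<infinity>" and eq: "ereal_integral M g = ereal v"
  shows "AE x in M. g x = ereal (real_of_ereal (g x))"
    and "integrable M (\<lambda>x. real_of_ereal (g x))"
    and "(\<integral>x. real_of_ereal (g x) \<partial>M) = v"
proof -
  define P Q where "P = (\<integral>\<^sup>+x. e2ennreal (g x) \<partial>M)" and "Q = (\<integral>\<^sup>+x. e2ennreal (- g x) \<partial>M)"
  have PQ: "enn2ereal P - enn2ereal Q = ereal v" using eq by (simp add: ereal_integral_def P_def Q_def)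
  have fin: "P \<noteq> \<infinity>" "Q \<noteq> \<infinity>" using PQ by (cases P; cases Q; simp)+
  have "AE x in M. e2ennreal (- g x) \<noteq> \<infinity>"
    using fin(2) unfolding Q_def by (intro nn_integral_PInf_AE) auto
  then show ae: "AE x in M. g x = ereal (real_of_ereal (g x))"
  proof eventually_elim
    case (elim x) then show ?case using lt[of x] by (cases "g x") (auto simp: e2ennreal_infty)
  qed
  have *: "e2ennreal (g x) = ennreal (real_of_ereal (g x))" "e2ennreal (- g x) = ennreal (- real_of_ereal (g x))"
    if "g x = ereal (real_of_ereal (g x))" for x
    by (subst that, simp add: ennreal_def e2ennreal_def sup_max)+
  have P: "(\<integral>\<^sup>+x. ennreal (real_of_ereal (g x)) \<partial>M) = P"
    unfolding P_def by (intro nn_integral_cong_AE eventually_mono[OF ae]) (simp add: *)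
  have Q: "(\<integral>\<^sup>+x. ennreal (- real_of_ereal (g x)) \<partial>M) = Q"
    unfolding Q_def by (intro nn_integral_cong_AE eventually_mono[OF ae]) (simp add: *)
  show int: "integrable M (\<lambda>x. real_of_ereal (g x))"
    unfolding real_integrable_def P Q using fin by auto
  have "(\<integral>x. real_of_ereal (g x) \<partial>M) = enn2real P - enn2real Q"
    unfolding real_lebesgue_integral_def[OF int] P Q by simp
  then show "(\<integral>x. real_of_ereal (g x) \<partial>M) = v"
    using PQ fin by (cases P; cases Q) auto
qed

lemma borel_measurable_coupling:
  assumes "\<sigma> \<in> couplings \<mu>\<^sub>0 \<mu>\<^sub>1"
  shows "fst \<in> measurable \<sigma> borel" "snd \<in> measurable \<sigma> borel"
proof -
  have sets: "sets \<sigma> = sets borel" using assms by (simp add: couplings_def)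
  show "fst \<in> measurable \<sigma> borel" "snd \<in> measurable \<sigma> borel"
    unfolding measurable_cong_sets[OF sets refl]
    by (intro borel_measurable_continuous_onI continuous_intros continuous_on_fst continuous_on_snd continuous_on_id)+
qed

text \<open>Complementary slackness: the cost minus \<open>\<phi>\<close> minus its transform is
  nonnegative, and its integral vanishes because the potential attains the dual value. It is
  therefore 0 almost everywhere, and \<open>b\<close> is the value of the transform at the
  endpoint.\<close>

lemma optimal_coupling_AE_potential:
  fixes \<phi> :: "'a::heine_borel \<Rightarrow> real"
  assumes p: "p > 1" and \<sigma>: "\<sigma> \<in> optimal_couplings p \<mu>\<^sub>0 \<mu>\<^sub>1" and fin: "transport_cost p \<mu>\<^sub>0 \<mu>\<^sub>1 < \<infinity>"
    and \<phi>: "kantorovich_potential p \<mu>\<^sub>0 \<mu>\<^sub>1 (\<lambda>x. ereal (\<phi> x))" "integrable \<mu>\<^sub>0 \<phi>"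
  shows "AE z in \<sigma>. \<exists>b. (\<forall>x. \<phi> x \<le> cost p x (snd z) - b) \<and> \<phi> (fst z) = cost p (fst z) (snd z) - b"
    and "integrable \<sigma> (\<lambda>z. cost p (fst z) (snd z))"
    and "(\<integral>z. cost p (fst z) (snd z) \<partial>\<sigma>) = enn2real (transport_cost p \<mu>\<^sub>0 \<mu>\<^sub>1)"
proof -
  have c: "\<sigma> \<in> couplings \<mu>\<^sub>0 \<mu>\<^sub>1" and opt: "coupling_cost p \<sigma> = transport_cost p \<mu>\<^sub>0 \<mu>\<^sub>1"
    using \<sigma> by (auto simp: optimal_couplings_def)
  note m [measurable] = borel_measurable_coupling[OF c]
  have d0: "distr \<sigma> borel fst = \<mu>\<^sub>0" and d1: "distr \<sigma> borel snd = \<mu>\<^sub>1"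
    using c by (auto simp: couplings_def)
  define T where "T = enn2real (transport_cost p \<mu>\<^sub>0 \<mu>\<^sub>1)"
  have T: "transport_cost p \<mu>\<^sub>0 \<mu>\<^sub>1 = ennreal T" using fin by (simp add: T_def)
  have T0: "T \<ge> 0" by (simp add: T_def)
  have cost_nonneg: "cost p x y \<ge> 0" for x y :: 'a using p by (simp add: cost_def)
  have [measurable]: "(\<lambda>z. cost p (fst z) (snd z)) \<in> borel_measurable \<sigma>"
    unfolding cost_def by measurable
  have nn: "(\<integral>\<^sup>+z. ennreal (cost p (fst z) (snd z)) \<partial>\<sigma>) = ennreal T"
    using opt by (simp add: coupling_cost_def T)
  show ic: "integrable \<sigma> (\<lambda>z. cost p (fst z) (snd z))"
    using nn cost_nonneg by (intro integrableI_nonneg) auto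
  show Ic: "(\<integral>z. cost p (fst z) (snd z) \<partial>\<sigma>) = enn2real (transport_cost p \<mu>\<^sub>0 \<mu>\<^sub>1)"
    using nn cost_nonneg by (subst integral_eq_nn_integral) (auto simp: T T0)
  define \<psi>e where "\<psi>e = c_transform p (\<lambda>x. ereal (\<phi> x))"
  define \<psi> where "\<psi> y = real_of_ereal (\<psi>e y)" for y
  have [measurable]: "\<psi>e \<in> borel_measurable borel"
    unfolding \<psi>e_def using p by (intro borel_measurable_c_transform) auto
  have \<psi>e_le: "\<psi>e y \<le> ereal (cost p x y - \<phi> x)" for x y
    unfolding \<psi>e_def c_transform_def by (rule INF_lower2[of x]) auto
  have \<psi>e_fin: "\<psi>e y \<noteq> \<infinity>" for y using \<psi>e_le[of y undefined] by auto
  \<comment> \<open>With \<open>\<phi>\<close> integrable and the cost finite, the dual equation can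
    be solved for the integral of the transform, which is thereby finite. The transform may equal
    \<open>-\<infinity>\<close> on a null set, hence the almost everywhere statements.\<close>
  have "ereal (\<integral>x. \<phi> x \<partial>\<mu>\<^sub>0) + ereal_integral \<mu>\<^sub>1 \<psi>e = ereal T"
    using \<phi> fin by (simp add: kantorovich_potential_def ereal_integral_real \<psi>e_def T T0 enn2ereal_ennreal)
  then have "ereal_integral \<mu>\<^sub>1 \<psi>e = ereal (T - (\<integral>x. \<phi> x \<partial>\<mu>\<^sub>0))"
    by (cases "ereal_integral \<mu>\<^sub>1 \<psi>e") auto
  moreover have "\<psi>e \<in> borel_measurable \<mu>\<^sub>1" unfolding d1[symmetric] by simp
  ultimately have ae: "AE y in \<mu>\<^sub>1. \<psi>e y = ereal (\<psi> y)" and i\<psi>: "integrable \<mu>\<^sub>1 \<psi>"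
    and I\<psi>: "(\<integral>y. \<psi> y \<partial>\<mu>\<^sub>1) = T - (\<integral>x. \<phi> x \<partial>\<mu>\<^sub>0)"
    using ereal_integral_eq_real[of \<psi>e \<mu>\<^sub>1] \<psi>e_fin unfolding \<psi>_def by auto
  have "\<phi> \<in> borel_measurable \<mu>\<^sub>0" using \<phi>(2) by auto
  then have [measurable]: "\<phi> \<in> borel_measurable borel" unfolding d0[symmetric] by simp
  have [measurable]: "\<psi> \<in> borel_measurable borel" unfolding \<psi>_def by measurable
  have i0: "integrable \<sigma> (\<lambda>z. \<phi> (fst z))" "(\<integral>z. \<phi> (fst z) \<partial>\<sigma>) = (\<integral>x. \<phi> x \<partial>\<mu>\<^sub>0)"
    using \<phi>(2) unfolding d0[symmetric] by (auto simp: integrable_distr_eq integral_distr)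
  have i1: "integrable \<sigma> (\<lambda>z. \<psi> (snd z))" "(\<integral>z. \<psi> (snd z) \<partial>\<sigma>) = (\<integral>x. \<psi> x \<partial>\<mu>\<^sub>1)"
    using i\<psi> unfolding d1[symmetric] by (auto simp: integrable_distr_eq integral_distr)
  have ae1: "AE z in \<sigma>. \<psi>e (snd z) = ereal (\<psi> (snd z))"
    using ae unfolding d1[symmetric] by (rule AE_distrD[rotated]) simp
  have le: "\<phi> x \<le> cost p x y - \<psi> y" if "\<psi>e y = ereal (\<psi> y)" for x y
    using \<psi>e_le[of y x] unfolding that by simp
  define D where "D z = cost p (fst z) (snd z) - \<phi> (fst z) - \<psi> (snd z)" for z
  have iD: "integrable \<sigma> D" unfolding D_def using ic i0 i1 by simp
  have "(\<integral>z. D z \<partial>\<sigma>) = 0"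
    unfolding D_def using ic i0 i1 Ic I\<psi> by (simp add: T T0)
  moreover have "AE z in \<sigma>. 0 \<le> D z" using ae1
  proof eventually_elim
    case (elim z)
    from le[OF elim, of "fst z"] show ?case by (simp add: D_def)
  qed
  ultimately have "AE z in \<sigma>. D z = 0" using integral_nonneg_eq_0_iff_AE[OF iD] by blast
  with ae1 show "AE z in \<sigma>. \<exists>b. (\<forall>x. \<phi> x \<le> cost p x (snd z) - b) \<and> \<phi> (fst z) = cost p (fst z) (snd z) - b"
  proof eventually_elim
    case (elim z)
    then show ?case using le[OF elim(1)] by (intro exI[of _ "\<psi> (snd z)"]) (auto simp: D_def)
  qed
qed

section \<open>Optimal geodesic plans\<close>

lemma OptGeo_measurable:
  assumes "\<pi> \<in> OptGeo p \<mu>\<^sub>0 \<mu>\<^sub>1"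
  shows "(\<lambda>\<gamma> :: real \<Rightarrow>\<^sub>C 'a::metric_space. \<gamma> t) \<in> measurable \<pi> borel"
    and "(\<lambda>\<gamma> :: real \<Rightarrow>\<^sub>C 'a. (\<gamma> 0, \<gamma> 1)) \<in> measurable \<pi> borel"
proof -
  have sets: "sets \<pi> = sets (restrict_space borel Geo)" using assms by (simp add: OptGeo_def)
  have cont: "continuous_on UNIV (\<lambda>\<gamma> :: real \<Rightarrow>\<^sub>C 'a. \<gamma> s)" for s
    unfolding continuous_on_iff by (meson UNIV_I dist_fun_lt_imp_dist_val_lt)
  show "(\<lambda>\<gamma> :: real \<Rightarrow>\<^sub>C 'a. \<gamma> t) \<in> measurable \<pi> borel"
    "(\<lambda>\<gamma> :: real \<Rightarrow>\<^sub>C 'a. (\<gamma> 0, \<gamma> 1)) \<in> measurable \<pi> borel"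
    unfolding measurable_cong_sets[OF sets refl]
    by (intro measurable_restrict_space1 borel_measurable_continuous_onI continuous_on_Pair cont)+
qed

lemma OptGeo_AE_Geo:
  assumes "\<pi> \<in> OptGeo p \<mu>\<^sub>0 \<mu>\<^sub>1"
  shows "AE \<gamma> in \<pi>. \<gamma> \<in> Geo"
proof -
  have "sets \<pi> = sets (restrict_space borel Geo)" using assms by (simp add: OptGeo_def)
  then have "space \<pi> = Geo" by (drule_tac sets_eq_imp_space_eq) (simp add: space_restrict_space)
  then show ?thesis using AE_space[of \<pi>] by simp
qed

lemma OptGeo_eval_measure:
  fixes \<mu>\<^sub>0 \<mu>\<^sub>1 :: "'a::heine_borel measure"
  assumes \<pi>: "\<pi> \<in> OptGeo p \<mu>\<^sub>0 \<mu>\<^sub>1"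
  shows "eval_measure \<pi> 0 = \<mu>\<^sub>0"
    and "prob_space (eval_measure \<pi> t)" "sets (eval_measure \<pi> t) = sets borel"
proof -
  have c: "distr \<pi> borel (\<lambda>\<gamma> :: real \<Rightarrow>\<^sub>C 'a. (\<gamma> 0, \<gamma> 1)) \<in> couplings \<mu>\<^sub>0 \<mu>\<^sub>1"
    using \<pi> by (simp add: OptGeo_def optimal_couplings_def)
  have m: "fst \<in> measurable borel (borel :: 'a measure)"
    by (intro borel_measurable_continuous_onI continuous_intros)
  show "eval_measure \<pi> 0 = \<mu>\<^sub>0"
    using c distr_distr[OF m OptGeo_measurable(2)[OF \<pi>]]
    by (simp_all add: couplings_def eval_measure_def comp_def)
  show "prob_space (eval_measure \<pi> t)"
    using \<pi> OptGeo_measurable(1)[OF \<pi>] unfolding eval_measure_def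
    by (intro prob_space.prob_space_distr) (auto simp: OptGeo_def)
  show "sets (eval_measure \<pi> t) = sets borel" by (simp add: eval_measure_def)
qed

lemma AE_distr_memI:
  assumes "f \<in> measurable M M'" "A \<in> sets M'" "emeasure (distr M M' f) (space M' - A) = 0"
  shows "AE x in M. f x \<in> A"
proof (rule AE_distrD[OF assms(1)])
  show "AE x in distr M M' f. x \<in> A"
    using assms by (intro AE_I'[of "space M' - A"]) (auto simp: null_sets_def)
qed

lemma integral_eval_measure:
  fixes h :: "'a::heine_borel \<Rightarrow> real"
  assumes \<pi>: "\<pi> \<in> OptGeo p \<mu>\<^sub>0 \<mu>\<^sub>1" and h: "h \<in> borel_measurable borel"
  shows "(\<integral>x. h x \<partial>eval_measure \<pi> t) = (\<integral>\<gamma>. h (\<gamma> t) \<partial>\<pi>)"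
    and "integrable (eval_measure \<pi> t) h \<longleftrightarrow> integrable \<pi> (\<lambda>\<gamma>. h (\<gamma> t))"
  unfolding eval_measure_def
  using OptGeo_measurable(1)[OF \<pi>] h by (simp_all add: integral_distr integrable_distr_eq)

text \<open>Transfer along the endpoint map. The third value is the same for all optimal plans,
  which is how a bound obtained from one plan reaches another.\<close>

lemma OptGeo_AE_potential:
  fixes \<phi> :: "'a::heine_borel \<Rightarrow> real"
  assumes p: "p > 1" and \<pi>: "\<pi> \<in> OptGeo p \<mu>\<^sub>0 \<mu>\<^sub>1" and fin: "transport_cost p \<mu>\<^sub>0 \<mu>\<^sub>1 < \<infinity>"
    and \<phi>: "kantorovich_potential p \<mu>\<^sub>0 \<mu>\<^sub>1 (\<lambda>x. ereal (\<phi> x))" "integrable \<mu>\<^sub>0 \<phi>"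
  shows "AE \<gamma> in \<pi>. \<exists>b. (\<forall>x. \<phi> x \<le> cost p x (\<gamma> 1) - b) \<and> \<phi> (\<gamma> 0) = cost p (\<gamma> 0) (\<gamma> 1) - b"
    and "integrable \<pi> (\<lambda>\<gamma>. dist (\<gamma> 0) (\<gamma> 1) powr p)"
    and "(\<integral>\<gamma>. dist (\<gamma> 0) (\<gamma> 1) powr p \<partial>\<pi>) = p * enn2real (transport_cost p \<mu>\<^sub>0 \<mu>\<^sub>1)"
proof -
  let ?e = "\<lambda>\<gamma> :: real \<Rightarrow>\<^sub>C 'a. (\<gamma> 0, \<gamma> 1)"
  have \<sigma>: "distr \<pi> borel ?e \<in> optimal_couplings p \<mu>\<^sub>0 \<mu>\<^sub>1" using \<pi> by (simp add: OptGeo_def)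
  then have c: "distr \<pi> borel ?e \<in> couplings \<mu>\<^sub>0 \<mu>\<^sub>1" by (simp add: optimal_couplings_def)
  note o = optimal_coupling_AE_potential[OF p \<sigma> fin \<phi>]
  note e [measurable] = OptGeo_measurable(2)[OF \<pi>]
  from AE_distrD[OF e o(1)]
  show "AE \<gamma> in \<pi>. \<exists>b. (\<forall>x. \<phi> x \<le> cost p x (\<gamma> 1) - b) \<and> \<phi> (\<gamma> 0) = cost p (\<gamma> 0) (\<gamma> 1) - b" by simp
  have m: "(\<lambda>z. cost p (fst z) (snd z)) \<in> borel_measurable (borel :: ('a \<times> 'a) measure)"
    using borel_measurable_coupling[OF c] unfolding cost_def measurable_distr_eq1 by measurable
  have "integrable \<pi> (\<lambda>\<gamma>. cost p (\<gamma> 0) (\<gamma> 1))"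
    using o(2) by (simp add: integrable_distr_eq[OF e m])
  from integrable_mult_right[OF this, of p]
  show "integrable \<pi> (\<lambda>\<gamma>. dist (\<gamma> 0) (\<gamma> 1) powr p)" using p by (simp add: cost_def)
  have "(\<integral>\<gamma>. cost p (\<gamma> 0) (\<gamma> 1) \<partial>\<pi>) = enn2real (transport_cost p \<mu>\<^sub>0 \<mu>\<^sub>1)"
    using o(3) by (simp add: integral_distr[OF e m])
  then show "(\<integral>\<gamma>. dist (\<gamma> 0) (\<gamma> 1) powr p \<partial>\<pi>) = p * enn2real (transport_cost p \<mu>\<^sub>0 \<mu>\<^sub>1)"
    using p by (simp add: cost_def field_simps)
qed

lemma transport_cost_finite:
  fixes B :: "'a::heine_borel set"
  assumes p: "p > 1" and \<pi>: "\<pi> \<in> OptGeo p \<mu>\<^sub>0 \<mu>\<^sub>1" and B: "\<And>x y. x \<in> B \<Longrightarrow> y \<in> B \<Longrightarrow> dist x y \<le> D"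
    and conc: "AE \<gamma> in \<pi>. \<gamma> 0 \<in> B" "AE \<gamma> in \<pi>. \<gamma> 1 \<in> B"
  shows "transport_cost p \<mu>\<^sub>0 \<mu>\<^sub>1 < \<infinity>"
proof -
  let ?e = "\<lambda>\<gamma> :: real \<Rightarrow>\<^sub>C 'a. (\<gamma> 0, \<gamma> 1)"
  interpret prob_space \<pi> using \<pi> by (simp add: OptGeo_def)
  have \<sigma>: "distr \<pi> borel ?e \<in> couplings \<mu>\<^sub>0 \<mu>\<^sub>1" "coupling_cost p (distr \<pi> borel ?e) = transport_cost p \<mu>\<^sub>0 \<mu>\<^sub>1"
    using \<pi> by (auto simp: OptGeo_def optimal_couplings_def)
  have m: "(\<lambda>z. ennreal (cost p (fst z) (snd z))) \<in> borel_measurable (borel :: ('a \<times> 'a) measure)"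
    using borel_measurable_coupling[OF \<sigma>(1)] unfolding cost_def measurable_distr_eq1 by measurable
  have "transport_cost p \<mu>\<^sub>0 \<mu>\<^sub>1 = (\<integral>\<^sup>+\<gamma>. ennreal (cost p (\<gamma> 0) (\<gamma> 1)) \<partial>\<pi>)"
    unfolding \<sigma>(2)[symmetric] coupling_cost_def
    by (subst nn_integral_distr[OF OptGeo_measurable(2)[OF \<pi>]]) (use m in auto)
  also have "\<dots> \<le> (\<integral>\<^sup>+\<gamma>. ennreal (D powr p / p) \<partial>\<pi>)"
  proof (rule nn_integral_mono_AE)
    show "AE \<gamma> in \<pi>. ennreal (cost p (\<gamma> 0) (\<gamma> 1)) \<le> ennreal (D powr p / p)"
      using conc by eventually_elim (use B p in \<open>auto simp: cost_def intro!: ennreal_leI divide_right_mono powr_mono2\<close>)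
  qed
  also have "\<dots> < \<infinity>" by (simp add: emeasure_space_1)
  finally show ?thesis .
qed

text \<open>Cutting off outside \<open>B\<close> makes the function bounded when
  \<open>\<phi>\<close> is Lipschitz near \<open>B\<close>. Note that \<open>enn2real\<close> sends
  an infinite slope to 0, which does not occur on \<open>B\<close> under the bound assumed
  below.\<close>

definition truncated_slope :: "'a::metric_space set \<Rightarrow> ('a \<Rightarrow> real) \<Rightarrow> real \<Rightarrow> real \<Rightarrow> 'a \<Rightarrow> real" where
  "truncated_slope B \<phi> q r x = indicator B x * enn2real (slope_ball \<phi> r x) powr q"

lemma truncated_slope_bounds:
  assumes "\<And>x. x \<in> B \<Longrightarrow> slope_ball \<phi> r x \<le> ennreal L" "L \<ge> 0" "q > 0"
  shows "0 \<le> truncated_slope B \<phi> q r x" "truncated_slope B \<phi> q r x \<le> L powr q"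
proof -
  show "0 \<le> truncated_slope B \<phi> q r x" by (simp add: truncated_slope_def)
  show "truncated_slope B \<phi> q r x \<le> L powr q"
  proof (cases "x \<in> B")
    case True
    have "enn2real (slope_ball \<phi> r x) \<le> L" using enn2real_mono[OF assms(1)[OF True]] assms(2) by simp
    then have "enn2real (slope_ball \<phi> r x) powr q \<le> L powr q" using assms(3) by (intro powr_mono2) auto
    then show ?thesis using True by (simp add: truncated_slope_def)
  qed (simp add: truncated_slope_def)
qed

lemma borel_measurable_truncated_slope:
  assumes "continuous_on UNIV \<phi>" "B \<in> sets borel"
  shows "truncated_slope B \<phi> q r \<in> borel_measurable borel"
proof -
  note [measurable] = borel_measurable_slope_ball[OF assms(1), of r] assms(2)
  show ?thesis unfolding truncated_slope_def[abs_def] by measurable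
qed

text \<open>The lower bound of \<open>slope_ball_ge_potential\<close> at
  \<open>z = \<gamma> t\<close>, raised to the power \<open>q\<close>;
  \<open>(p - 1) * q = p\<close> turns the exponents into \<open>p\<close>.\<close>

lemma truncated_slope_along_geodesic:
  fixes \<phi> :: "'a::metric_space \<Rightarrow> real"
  assumes p: "p > 1" and pq: "(p - 1) * q = p" and \<gamma>: "\<gamma> \<in> Geo" "\<gamma> t \<in> B" and t: "0 < t" "t < 1"
    and pot: "\<And>x. \<phi> x \<le> cost p x (\<gamma> 1) - b" "\<phi> (\<gamma> 0) = cost p (\<gamma> 0) (\<gamma> 1) - b"
    and r: "t * dist (\<gamma> 0) (\<gamma> 1) < r" and L: "slope_ball \<phi> r (\<gamma> t) \<le> ennreal L"
  shows "(1 - t) powr p * dist (\<gamma> 0) (\<gamma> 1) powr p \<le> truncated_slope B \<phi> q r (\<gamma> t)"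
proof -
  define d where "d = dist (\<gamma> 0) (\<gamma> 1)"
  have geo: "dist (\<gamma> s) (\<gamma> u) = \<bar>s - u\<bar> * d" if "s \<in> {0..1}" "u \<in> {0..1}" for s u
    using \<gamma>(1) that unfolding Geo_def d_def by blast
  have "q > 0" using pq p by (metis less_trans zero_less_one diff_gt_0_iff_gt zero_less_mult_pos)
  have "ennreal ((1 - t) powr (p - 1) * d powr (p - 1)) \<le> slope_ball \<phi> r (\<gamma> t)"
    unfolding d_def
    by (rule slope_ball_ge_potential[OF p pot(1)[of "\<gamma> t"] pot(2) t _ _ r]) (use geo[of 0 t] geo[of t 1] t in \<open>auto simp: d_def\<close>)
  \<comment> \<open>Finiteness of the slope, from \<open>L\<close>, is needed here:
    \<open>enn2real\<close> is not monotone at infinity.\<close>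
  then have "enn2real (ennreal ((1 - t) powr (p - 1) * d powr (p - 1))) \<le> enn2real (slope_ball \<phi> r (\<gamma> t))"
    using L by (intro enn2real_mono) (auto intro: le_less_trans)
  then have "((1 - t) powr (p - 1) * d powr (p - 1)) powr q \<le> enn2real (slope_ball \<phi> r (\<gamma> t)) powr q"
    using \<open>q > 0\<close> by (intro powr_mono2) auto
  also have "((1 - t) powr (p - 1) * d powr (p - 1)) powr q = (1 - t) powr p * d powr p"
    by (simp add: powr_mult powr_powr pq)
  finally show ?thesis using \<gamma>(2) by (simp add: truncated_slope_def d_def)
qed

section \<open>Equality of slope and distance along every optimal plan\<close>

theorem proposition4p13:
  fixes \<mu> \<mu>\<^sub>0 \<mu>\<^sub>1 :: "'a::heine_borel measure"
    and p q N :: real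
    and B :: "'a set"
    and \<pi> \<pi>' :: "(real \<Rightarrow>\<^sub>C 'a) measure"
    and \<phi> :: "'a \<Rightarrow> real"
  assumes "p > 1" and "1 / p + 1 / q = 1" and "N > 1"
    and "geodesic_space TYPE('a)"
    and "locally_finite_borel_measure \<mu>"
    and "bounded B" and "closed B" and "emeasure \<mu> B < \<infinity>"
    and "\<mu>\<^sub>0 \<in> prob_moment p" and "\<mu>\<^sub>1 \<in> prob_moment p"
    and "absolutely_continuous \<mu> \<mu>\<^sub>0"
    and "\<pi> \<in> OptGeo p \<mu>\<^sub>0 \<mu>\<^sub>1"
    and "((\<lambda>t. entropy_functional N \<mu> (eval_measure \<pi> t)) \<longlongrightarrow> entropy_functional N \<mu> \<mu>\<^sub>0)
           (at 0 within {0..1})"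
    and "\<forall>t\<in>{0..1}. measure_supp (eval_measure \<pi> t) \<subseteq> B"
    and "kantorovich_potential p \<mu>\<^sub>0 \<mu>\<^sub>1 (\<lambda>x. ereal (\<phi> x))"
    and "lipschitz_on_bounded_sets \<phi>"
    and "\<pi>' \<in> OptGeo p \<mu>\<^sub>0 \<mu>\<^sub>1"
  shows "AE \<gamma> in \<pi>'.
    ennreal (dist (\<gamma> 0) (\<gamma> 1) powr p) = ennreal_powr (ascending_slope \<phi> (\<gamma> 0)) q"
proof -
  note p = \<open>p > 1\<close> and N = \<open>N > 1\<close> and \<pi> = \<open>\<pi> \<in> OptGeo p \<mu>\<^sub>0 \<mu>\<^sub>1\<close> and \<pi>' = \<open>\<pi>' \<in> OptGeo p \<mu>\<^sub>0 \<mu>\<^sub>1\<close>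
  \<comment> \<open>For \<open>q = 0\<close> the convention \<open>1 / 0 = 0\<close> would turn the
    conjugacy relation into \<open>1 / p = 1\<close>.\<close>
  have "q \<noteq> 0" using assms(1,2) by (intro notI) simp
  then have pq: "(p - 1) * q = p" using assms(1,2) by (simp add: field_simps)
  then have q: "q > 0" using p by (metis less_trans zero_less_one diff_gt_0_iff_gt zero_less_mult_pos)
  have sets\<mu>: "sets \<mu> = sets borel" using assms(5) by (simp add: locally_finite_borel_measure_def)
  then have sp\<mu>: "space \<mu> = UNIV" by (metis sets_eq_imp_space_eq space_borel)
  have sf: "sigma_finite_measure \<mu>" by (rule locally_finite_sigma_finite[OF assms(5)])
  have BB [measurable]: "B \<in> sets borel" using assms(7) by simp
  then have B\<mu>: "B \<in> sets \<mu>" using sets\<mu> by simp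
  interpret \<pi>: prob_space \<pi> using \<pi> by (simp add: OptGeo_def)
  interpret \<pi>': prob_space \<pi>' using \<pi>' by (simp add: OptGeo_def)
  note ev = OptGeo_eval_measure[OF \<pi>] and ev' = OptGeo_eval_measure[OF \<pi>']
  have cont: "continuous_on UNIV \<phi>" by (rule lipschitz_on_bounded_sets_continuous[OF assms(16)])
  note \<phi>_meas [measurable] = borel_measurable_continuous_onI[OF cont]
  have null: "emeasure (eval_measure \<pi> t) (- B) = 0" if "t \<in> {0..1}" for t
    using assms(14) that by (intro measure_supp_null[OF ev(3) _ assms(7)]) auto
  have inB: "AE \<gamma> in \<pi>. \<gamma> t \<in> B" if "t \<in> {0..1}" for t
    using null[OF that] unfolding eval_measure_def
    by (intro AE_distr_memI[OF OptGeo_measurable(1)[OF \<pi>] BB]) (simp add: Compl_eq_Diff_UNIV)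
  have inB0: "AE x in \<mu>\<^sub>0. x \<in> B"
    using null[of 0] BB ev(3)[of 0] unfolding ev(1) by (intro AE_I'[of "- B"]) (auto simp: null_sets_def)
  interpret \<mu>\<^sub>0: prob_space \<mu>\<^sub>0 using ev(2)[of 0] unfolding ev(1) .
  have sets\<mu>\<^sub>0 [measurable_cong]: "sets \<mu>\<^sub>0 = sets borel" using ev(3)[of 0] unfolding ev(1) .

  obtain D0 where D0: "\<And>x y. x \<in> B \<Longrightarrow> y \<in> B \<Longrightarrow> dist x y \<le> D0"
    using assms(6) bounded_two_points by metis
  define D where "D = max D0 1"
  have D: "dist x y \<le> D" if "x \<in> B" "y \<in> B" for x y using D0[OF that] by (simp add: D_def)
  have D1: "D \<ge> 1" by (simp add: D_def)
  have fin: "transport_cost p \<mu>\<^sub>0 \<mu>\<^sub>1 < \<infinity>"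
    by (rule transport_cost_finite[OF p \<pi> D inB inB]) auto
  obtain a R where aR: "B \<subseteq> cball a R" using assms(6) bounded_subset_cball by blast
  \<comment> \<open>The enlarged ball contains every ball of radius at most 1 centred in
    \<open>B\<close>, so one constant bounds all slopes at such scales.\<close>
  have "\<exists>L. L-lipschitz_on (cball a (R + 1)) \<phi>"
    using assms(16) by (auto simp: lipschitz_on_bounded_sets_def)
  then obtain L where L: "L-lipschitz_on (cball a (R + 1)) \<phi>" ..
  then have L0: "L \<ge> 0" by (rule lipschitz_on_nonneg)
  have slope_L: "slope_ball \<phi> r x \<le> ennreal L" if "x \<in> B" "0 < r" "r \<le> 1" for r x
  proof (rule slope_ball_le_lipschitz[OF L _ that(2)])
    show "ball x r \<subseteq> cball a (R + 1)"
    proof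
      fix y assume "y \<in> ball x r"
      moreover have "dist a x \<le> R" using aR that by auto
      ultimately show "y \<in> cball a (R + 1)"
        using dist_triangle[of a y x] that by simp
    qed
  qed
  have int\<phi>: "integrable \<mu>\<^sub>0 \<phi>"
  proof -
    have "bounded (\<phi> ` B)"
      using assms(6,7) by (intro compact_imp_bounded compact_continuous_image continuous_on_subset[OF cont])
        (auto simp: compact_eq_bounded_closed)
    then obtain C where "\<And>x. x \<in> B \<Longrightarrow> norm (\<phi> x) \<le> C" by (auto simp: bounded_iff)
    then show ?thesis using inB0
      by (intro \<mu>\<^sub>0.integrable_const_bound[where B=C]) (auto elim: eventually_mono)
  qed
  note pot = OptGeo_AE_potential[OF p \<pi> fin assms(15) int\<phi>]
    and pot' = OptGeo_AE_potential[OF p \<pi>' fin assms(15) int\<phi>]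
  \<comment> \<open>By \<open>pot(3)\<close> and \<open>pot'(3)\<close>, \<open>A\<close> is the
    integral of the \<open>p\<close>-th power of the distance for both plans.\<close>
  define A where "A = p * enn2real (transport_cost p \<mu>\<^sub>0 \<mu>\<^sub>1)"

  have fm: "finite_measure (eval_measure \<pi> t)" for t
    using ev(2) by (rule prob_space.finite_measure)
  have "\<exists>\<rho> \<nu>\<^sub>s. lebesgue_decomposition \<mu> (eval_measure \<pi> t) \<rho> \<nu>\<^sub>s" for t
    by (rule lebesgue_decomposition_exists[OF sf fm]) (simp add: ev(3) sets\<mu>)
  then obtain \<rho> \<nu>\<^sub>s where dec: "\<And>t. lebesgue_decomposition \<mu> (eval_measure \<pi> t) (\<rho> t) (\<nu>\<^sub>s t)" by metis
  have ent: "entropy_functional N \<mu> (eval_measure \<pi> t) = ereal (N - N * (\<integral>x. \<rho> t x powr (1 - 1 / N) \<partial>\<mu>))"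
    if "t \<in> {0..1}" for t
    using entropy_functional_eq[OF sf fm _ N B\<mu> assms(8) _ dec] null[OF that] prob_space.prob_space[OF ev(2)]
    by (simp add: ev(3) sets\<mu> sp\<mu> Compl_eq_Diff_UNIV[symmetric])
  have nonneg\<rho>: "\<rho> t x \<ge> 0" for t x using dec[of t] by (simp add: lebesgue_decomposition_def)
  have int\<rho>: "integrable \<mu> (\<rho> t)" for t
    by (rule lebesgue_decomposition_integrable(1)[OF fm _ dec]) (simp add: ev(3) sets\<mu>)
  have conc\<rho>: "AE x in \<mu>. x \<notin> B \<longrightarrow> \<rho> 0 x = 0"
    using null[of 0] by (intro lebesgue_decomposition_concentrated[OF _ B\<mu> _ dec])
      (auto simp: ev(3) sets\<mu> sp\<mu> Compl_eq_Diff_UNIV[symmetric])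
  \<comment> \<open>At time 0 the singular part is absent by absolute continuity.\<close>
  have dens: "density \<mu> (\<lambda>x. ennreal (\<rho> 0 x)) = \<mu>\<^sub>0"
    using lebesgue_decomposition_absolutely_continuous[OF _ _ dec[of 0]] assms(11) ev(3)[of 0] sets\<mu>
    unfolding ev(1) by simp
  have int_dens: "(\<integral>x. \<rho> 0 x * h x \<partial>\<mu>) = (\<integral>x. h x \<partial>\<mu>\<^sub>0)" if "h \<in> borel_measurable borel" for h :: "'a \<Rightarrow> real"
  proof -
    have "h \<in> borel_measurable \<mu>" using that by (simp add: measurable_cong_sets[OF sets\<mu> refl])
    then show ?thesis
      unfolding dens[symmetric] using int\<rho>[of 0] nonneg\<rho> by (subst integral_real_density) auto
  qed

  \<comment> \<open>At a fixed scale \<open>r\<close>, \<open>limit_bound\<close> is applied to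
    \<open>K - ?g\<close>, where \<open>?g\<close> is the truncated slope: an upper bound for its
    integral against the limit \<open>\<mu>\<^sub>0\<close> is the desired lower bound for that of
    \<open>?g\<close>.\<close>
  have ball_bound: "A \<le> (\<integral>x. truncated_slope B \<phi> q r x \<partial>\<mu>\<^sub>0)" if r: "0 < r" "r \<le> 1" for r
  proof -
    define K where "K = L powr q"
    let ?g = "truncated_slope B \<phi> q r"
    have g01: "0 \<le> ?g x" "?g x \<le> K" for x
      unfolding K_def using truncated_slope_bounds[OF slope_L[OF _ r] L0 q] by blast+
    have [measurable]: "?g \<in> borel_measurable borel"
      by (rule borel_measurable_truncated_slope[OF cont BB])
    \<comment> \<open>The shift \<open>m\<close> makes \<open>t n * D < r\<close> for every
      \<open>n\<close>, so that the initial point of a geodesic lies within \<open>r\<close> of its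
      point at time \<open>t n\<close>. As \<open>D\<close> is positive, so is \<open>m\<close>,
      whence \<open>t n < 1\<close>.\<close>
    obtain m where m: "D / r < real m" using reals_Archimedean2 by blast
    define t where "t n = 1 / (real n + real m + 1)" for n
    have m0: "real m > 0" using m D1 r by (smt (verit) divide_pos_pos)
    have t01: "0 < t n" "t n < 1" for n using m0 by (auto simp: t_def)
    have tD: "t n * D < r" for n
    proof -
      have "D < real m * r" using m r by (simp add: divide_less_eq)
      also have "\<dots> \<le> (real n + real m + 1) * r" using r by (intro mult_right_mono) auto
      finally show ?thesis using m0 by (simp add: t_def divide_less_eq mult.commute)
    qed
    have t_lim: "t \<longlonglongrightarrow> 0"
    proof -
      have "(\<lambda>n. 1 / real (Suc (n + m))) \<longlonglongrightarrow> 0"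
        using LIMSEQ_ignore_initial_segment[OF LIMSEQ_inverse_real_of_nat, of m] by (simp only: inverse_eq_divide)
      then show ?thesis by (simp add: t_def[abs_def] add.commute add.left_commute)
    qed
    have t_filter: "filterlim t (at 0 within {0..1}) sequentially"
      using t_lim t01 by (auto simp: filterlim_at less_imp_le order_less_imp_not_eq2 intro!: always_eventually)
    \<comment> \<open>The bound that the inequality along geodesics gives for the integral of
      \<open>K - ?g\<close> at time \<open>t n\<close>; it tends to \<open>K - A\<close>.\<close>
    define cs where "cs n = K - (1 - t n) powr p * A" for n
    interpret entropy_convergence \<mu> "\<lambda>n. eval_measure \<pi> (t n)" "\<lambda>n. \<rho> (t n)" "\<lambda>n. \<nu>\<^sub>s (t n)" "\<rho> 0"
      "\<lambda>x. K - ?g x" N K "K - A" cs B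
    proof (rule entropy_convergence.intro)
      show "(\<lambda>n. \<integral>x. h x \<partial>eval_measure \<pi> (t n)) \<longlonglongrightarrow> (\<integral>x. \<rho> 0 x * h x \<partial>\<mu>)"
        if h: "continuous_on UNIV h" "bounded (range h)" for h :: "'a \<Rightarrow> real"
      proof -
        note hm [measurable] = borel_measurable_continuous_onI[OF h(1)]
        note [measurable] = OptGeo_measurable(1)[OF \<pi>]
        obtain C where C: "\<And>x. norm (h x) \<le> C" using h(2) by (auto simp: bounded_iff)
        \<comment> \<open>Weak convergence comes from the plan: the curves are continuous, and
          \<open>h\<close> is bounded.\<close>
        have "(\<lambda>n. \<integral>\<gamma>. h (\<gamma> (t n)) \<partial>\<pi>) \<longlonglongrightarrow> (\<integral>\<gamma>. h (\<gamma> 0) \<partial>\<pi>)"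
        proof (rule integral_dominated_convergence[where w="\<lambda>_. C"])
          show "AE \<gamma> in \<pi>. (\<lambda>n. h (\<gamma> (t n))) \<longlonglongrightarrow> h (\<gamma> 0)"
          proof (rule AE_I2)
            fix \<gamma> :: "real \<Rightarrow>\<^sub>C 'a"
            have "isCont (apply_bcontfun \<gamma>) 0" "isCont h (\<gamma> 0)"
              using h(1) continuous_on_apply_bcontfun[of UNIV \<gamma>]
              unfolding continuous_on_eq_continuous_at[OF open_UNIV] by blast+
            then show "(\<lambda>n. h (\<gamma> (t n))) \<longlonglongrightarrow> h (\<gamma> 0)"
              using t_lim by (intro isCont_tendsto_compose[of _ h] isCont_tendsto_compose[of _ "apply_bcontfun \<gamma>"])
          qed
        qed (use C in auto)
        then show ?thesis
          unfolding int_dens[OF hm] integral_eval_measure(1)[OF \<pi> hm, symmetric] ev(1) .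
      qed
      have "(\<lambda>n. entropy_functional N \<mu> (eval_measure \<pi> (t n))) \<longlonglongrightarrow> entropy_functional N \<mu> (eval_measure \<pi> 0)"
        unfolding ev(1) by (rule filterlim_compose[OF assms(13) t_filter])
      then have "(\<lambda>n. N - N * (\<integral>x. \<rho> (t n) x powr (1 - 1 / N) \<partial>\<mu>)) \<longlonglongrightarrow> N - N * (\<integral>x. \<rho> 0 x powr (1 - 1 / N) \<partial>\<mu>)"
        using t01 by (simp add: ent less_imp_le)
      from tendsto_divide[OF tendsto_diff[OF tendsto_const[of N] this] tendsto_const[of N]] N
      show "(\<lambda>n. \<integral>x. \<rho> (t n) x powr (1 - 1 / N) \<partial>\<mu>) \<longlonglongrightarrow> (\<integral>x. \<rho> 0 x powr (1 - 1 / N) \<partial>\<mu>)" by simp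
      show "(\<integral>x. K - ?g x \<partial>eval_measure \<pi> (t n)) \<le> cs n" for n
      proof -
        interpret \<nu>: prob_space "eval_measure \<pi> (t n)" by (rule ev(2))
        have ig: "integrable (eval_measure \<pi> (t n)) ?g"
          using g01 by (intro \<nu>.integrable_const_bound[where B=K])
            (auto simp: measurable_cong_sets[OF ev(3) refl])
        have "(1 - t n) powr p * A = (\<integral>\<gamma>. (1 - t n) powr p * dist (\<gamma> 0) (\<gamma> 1) powr p \<partial>\<pi>)"
          unfolding A_def pot(3)[symmetric] by simp
        also have "\<dots> \<le> (\<integral>\<gamma>. ?g (\<gamma> (t n)) \<partial>\<pi>)"
        proof (rule integral_mono_AE)
          show "integrable \<pi> (\<lambda>\<gamma>. (1 - t n) powr p * dist (\<gamma> 0) (\<gamma> 1) powr p)" using pot(2) by simp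
          show "integrable \<pi> (\<lambda>\<gamma>. ?g (\<gamma> (t n)))" using ig by (simp add: integral_eval_measure(2)[OF \<pi>])
          have "AE \<gamma> in \<pi>. \<gamma> 0 \<in> B" "AE \<gamma> in \<pi>. \<gamma> 1 \<in> B" "AE \<gamma> in \<pi>. \<gamma> (t n) \<in> B"
            using t01[of n] by (auto intro!: inB)
          with pot(1) OptGeo_AE_Geo[OF \<pi>]
          show "AE \<gamma> in \<pi>. (1 - t n) powr p * dist (\<gamma> 0) (\<gamma> 1) powr p \<le> ?g (\<gamma> (t n))"
          proof eventually_elim
            case (elim \<gamma>)
            then obtain b where b: "\<And>x. \<phi> x \<le> cost p x (\<gamma> 1) - b" "\<phi> (\<gamma> 0) = cost p (\<gamma> 0) (\<gamma> 1) - b" by blast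
            have "t n * dist (\<gamma> 0) (\<gamma> 1) \<le> t n * D"
              using D elim t01[of n] by (intro mult_left_mono) auto
            with tD[of n] have "t n * dist (\<gamma> 0) (\<gamma> 1) < r" by linarith
            then show ?case
              using elim by (intro truncated_slope_along_geodesic[OF p pq _ _ t01 b _ slope_L[OF _ r]])
          qed
        qed
        also have "\<dots> = (\<integral>x. ?g x \<partial>eval_measure \<pi> (t n))" by (simp add: integral_eval_measure(1)[OF \<pi>])
        finally show ?thesis using ig by (simp add: cs_def \<nu>.prob_space)
      qed
      have "(\<lambda>n. (1 - t n) powr p) \<longlonglongrightarrow> (1 - 0) powr p" by (intro tendsto_intros t_lim) simp
      from tendsto_diff[OF tendsto_const[of K] tendsto_mult[OF this tendsto_const[of A]]]
      show "cs \<longlonglongrightarrow> K - A" by (simp add: cs_def[abs_def])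
      show "sets (eval_measure \<pi> (t n)) = sets \<mu>" for n by (simp add: ev(3) sets\<mu>)
      show "emeasure (eval_measure \<pi> (t n)) (space \<mu> - B) = 0" for n
        using null[of "t n"] t01[of n] by (simp add: sp\<mu> Compl_eq_Diff_UNIV less_imp_le)
      show "(\<lambda>x. K - ?g x) \<in> borel_measurable borel" by measurable
      show "0 \<le> K - ?g x" "K - ?g x \<le> K" for x using g01[of x] by auto
    qed (fact sets\<mu> fm N B\<mu> assms(8) dec int\<rho> nonneg\<rho> conc\<rho>)+
    have ig: "integrable \<mu>\<^sub>0 ?g" using g01 by (intro \<mu>\<^sub>0.integrable_const_bound[where B=K]) auto
    have "(\<integral>x. K - ?g x \<partial>\<mu>\<^sub>0) \<le> K - A" using limit_bound by (subst (asm) int_dens) measurable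
    then show ?thesis using ig by (simp add: \<mu>\<^sub>0.prob_space)
  qed

  \<comment> \<open>The pointwise limit of the truncated slopes as the scale tends to 0.\<close>
  define S where "S x = indicator B x * enn2real (ascending_slope \<phi> x) powr q" for x
  note [measurable] = borel_measurable_ascending_slope[OF cont]
  have S_meas [measurable]: "S \<in> borel_measurable borel" unfolding S_def[abs_def] by measurable
  have asc_L: "ascending_slope \<phi> x \<le> ennreal L" if "x \<in> B" for x
    using ascending_slope_le[of 1 \<phi> x] slope_L[OF that, of 1] by simp
  have S_bounds: "0 \<le> S x" "S x \<le> L powr q" for x
  proof -
    show "0 \<le> S x" by (simp add: S_def)
    show "S x \<le> L powr q"
    proof (cases "x \<in> B")
      case True
      have "enn2real (ascending_slope \<phi> x) \<le> L" using enn2real_mono[OF asc_L[OF True]] L0 by simp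
      then have "enn2real (ascending_slope \<phi> x) powr q \<le> L powr q" using q by (intro powr_mono2) auto
      then show ?thesis using True by (simp add: S_def)
    qed (simp add: S_def)
  qed
  have iS: "integrable \<mu>\<^sub>0 S"
    using S_bounds by (intro \<mu>\<^sub>0.integrable_const_bound[where B="L powr q"]) auto
  have A_le: "A \<le> (\<integral>x. S x \<partial>\<mu>\<^sub>0)"
  proof (rule LIMSEQ_le_const)
    show "\<exists>n. \<forall>k\<ge>n. A \<le> (\<integral>x. truncated_slope B \<phi> q (1 / real (Suc k)) x \<partial>\<mu>\<^sub>0)"
      by (intro exI allI impI ball_bound) auto
    have tm: "truncated_slope B \<phi> q r \<in> borel_measurable \<mu>\<^sub>0" for r
      using borel_measurable_truncated_slope[OF cont BB] by (simp add: measurable_cong_sets[OF sets\<mu>\<^sub>0 refl])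
    show "(\<lambda>k. \<integral>x. truncated_slope B \<phi> q (1 / real (Suc k)) x \<partial>\<mu>\<^sub>0) \<longlonglongrightarrow> (\<integral>x. S x \<partial>\<mu>\<^sub>0)"
    proof (rule integral_dominated_convergence[OF _ tm, where w="\<lambda>_. L powr q"])
      show "AE x in \<mu>\<^sub>0. (\<lambda>k. truncated_slope B \<phi> q (1 / real (Suc k)) x) \<longlonglongrightarrow> S x"
      proof (rule AE_I2)
        fix x
        show "(\<lambda>k. truncated_slope B \<phi> q (1 / real (Suc k)) x) \<longlonglongrightarrow> S x"
        proof (cases "x \<in> B")
          case True
          have "ascending_slope \<phi> x \<noteq> top" using asc_L[OF True] by (auto simp: top_unique)
          then have "(\<lambda>k. enn2real (slope_ball \<phi> (1 / real (Suc k)) x)) \<longlonglongrightarrow> enn2real (ascending_slope \<phi> x)"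
            using slope_ball_tendsto[of \<phi> x] by (intro tendsto_enn2real) (simp_all add: less_top)
          then have "(\<lambda>k. enn2real (slope_ball \<phi> (1 / real (Suc k)) x) powr q) \<longlonglongrightarrow> enn2real (ascending_slope \<phi> x) powr q"
            using q by (intro tendsto_powr' tendsto_const) auto
          then show ?thesis using True by (simp add: truncated_slope_def S_def)
        qed (simp add: truncated_slope_def S_def)
      qed
      show "AE x in \<mu>\<^sub>0. norm (truncated_slope B \<phi> q (1 / real (Suc k)) x) \<le> L powr q" for k
      proof (rule AE_I2)
        fix x
        have "(0::real) < 1 / real (Suc k)" "1 / real (Suc k) \<le> 1" by auto
        then have "0 \<le> truncated_slope B \<phi> q (1 / real (Suc k)) x"
          "truncated_slope B \<phi> q (1 / real (Suc k)) x \<le> L powr q"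
          using truncated_slope_bounds[OF slope_L L0 q] by blast+
        then show "norm (truncated_slope B \<phi> q (1 / real (Suc k)) x) \<le> L powr q" by simp
      qed
    qed auto
  qed

  have "emeasure (eval_measure \<pi>' 0) (- B) = 0" using null[of 0] unfolding ev(1) ev'(1) by simp
  then have inB': "AE \<gamma> in \<pi>'. \<gamma> 0 \<in> B"
    unfolding eval_measure_def
    by (intro AE_distr_memI[OF OptGeo_measurable(1)[OF \<pi>'] BB]) (simp add: Compl_eq_Diff_UNIV)
  \<comment> \<open>The pointwise inequality opposite to the integrated bound \<open>A_le\<close>,
    now along the second plan.\<close>
  have le: "AE \<gamma> in \<pi>'. S (\<gamma> 0) \<le> dist (\<gamma> 0) (\<gamma> 1) powr p"
    using pot'(1) inB'
  proof eventually_elim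
    case (elim \<gamma>)
    then obtain b where b: "\<And>x. \<phi> x \<le> cost p x (\<gamma> 1) - b" "\<phi> (\<gamma> 0) = cost p (\<gamma> 0) (\<gamma> 1) - b" by blast
    have "enn2real (ascending_slope \<phi> (\<gamma> 0)) \<le> dist (\<gamma> 0) (\<gamma> 1) powr (p - 1)"
      using enn2real_mono[OF ascending_slope_le_potential[OF p b]] by simp
    then have "enn2real (ascending_slope \<phi> (\<gamma> 0)) powr q \<le> (dist (\<gamma> 0) (\<gamma> 1) powr (p - 1)) powr q"
      using q by (intro powr_mono2) auto
    then show ?case using elim(2) by (simp add: S_def powr_powr pq)
  qed
  \<comment> \<open>The second plan has the same first marginal and the same cost as the first, so
    \<open>A_le\<close> gives \<open>E\<close> a nonpositive integral, while \<open>E\<close> is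
    nonnegative almost everywhere.\<close>
  define E where "E \<gamma> = dist (\<gamma> 0) (\<gamma> 1) powr p - S (\<gamma> 0)" for \<gamma> :: "real \<Rightarrow>\<^sub>C 'a"
  have iS': "integrable \<pi>' (\<lambda>\<gamma>. S (\<gamma> 0))" "(\<integral>\<gamma>. S (\<gamma> 0) \<partial>\<pi>') = (\<integral>x. S x \<partial>\<mu>\<^sub>0)"
    using iS unfolding integral_eval_measure[OF \<pi>' S_meas, symmetric] ev'(1) by auto
  have iE: "integrable \<pi>' E" unfolding E_def using iS'(1) pot'(2) by simp
  have "(\<integral>\<gamma>. E \<gamma> \<partial>\<pi>') \<le> 0"
    unfolding E_def using iS' pot'(2,3) A_le by (simp add: A_def)
  moreover have nonneg: "AE \<gamma> in \<pi>'. 0 \<le> E \<gamma>" using le by eventually_elim (simp add: E_def)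
  ultimately have "(\<integral>\<gamma>. E \<gamma> \<partial>\<pi>') = 0" using integral_nonneg_AE[OF nonneg] by simp
  then have "AE \<gamma> in \<pi>'. E \<gamma> = 0" using integral_nonneg_eq_0_iff_AE[OF iE nonneg] by blast
  then show ?thesis using inB'
  proof eventually_elim
    case (elim \<gamma>)
    \<comment> \<open>Finiteness of the slope on \<open>B\<close> ensures that nothing is lost by
      \<open>enn2real\<close>, and selects the finite branch of \<open>ennreal_powr\<close>.\<close>
    have "ascending_slope \<phi> (\<gamma> 0) \<noteq> \<infinity>" using asc_L[OF elim(2)] by (auto simp: top_unique)
    then show ?case using elim by (simp add: ennreal_powr_def E_def S_def)
  qed
qed

end
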